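(* Let $K$ be a field of characteristic zero which is algebraically closed in a field $L\supseteq K$, let $x=(x_1,\dots,x_n)$ and $H\in L[x]^m$ with $\operatorname{trdeg}_K K(H)\le\operatorname{trdeg}_L L(H)$. Let $\tilde L$ be an extension field of $L$ and let $a\in\tilde L^m$ be an image apex of $H$ over $K$. Then there exist $\mu_1,\dots,\mu_r\in\tilde L$, linearly independent over $K$, with $\mu_1+\cdots+\mu_r=1$, and $a^{(1)},\dots,a^{(r)}\in K^m$, such that $a=\mu_1a^{(1)}+\cdots+\mu_ra^{(r)}$ and each $a^{(i)}$ is an image apex of $H$ over $\tilde L$.
   Context: With $y=(y_1,\dots,y_m)$, a new indeterminate $t$ and a field $F\supseteq K$: a vector $a$ with entries in an extension field of $L$ containing $F$ is an image apex of $H$ over $F$ if for every $f\in F[y]$, $f(H)=0$ implies $f((1-t)H+ta)=0$. $F(H)$ is the field generated over $F$ by the components of $H$, $\operatorname{trdeg}$ its transcendence degree. *)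

theory Defs
  imports "HOL-Library.Poly_Mapping" "HOL-Computational_Algebra.Polynomial"
          "HOL-Computational_Algebra.Fraction_Field"
begin

type_synonym 'a mpoly = "(nat \<Rightarrow>\<^sub>0 nat) \<Rightarrow>\<^sub>0 'a"

definition mconst :: "'a::comm_ring_1 \<Rightarrow> 'a mpoly" where
  "mconst c = Poly_Mapping.single 0 c"

definition mvar :: "nat \<Rightarrow> 'a::comm_ring_1 mpoly" where
  "mvar i = Poly_Mapping.single (Poly_Mapping.single i 1) 1"

definition coeffs_in :: "'a::zero set \<Rightarrow> 'a mpoly \<Rightarrow> bool" where
  "coeffs_in F p \<longleftrightarrow> (\<forall>\<alpha>\<in>Poly_Mapping.keys p. Poly_Mapping.lookup p \<alpha> \<in> F)"

definition vars_in :: "nat set \<Rightarrow> 'a::zero mpoly \<Rightarrow> bool" where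
  "vars_in V p \<longleftrightarrow> (\<forall>\<alpha>\<in>Poly_Mapping.keys p. Poly_Mapping.keys \<alpha> \<subseteq> V)"

definition poly_ring :: "'a::zero set \<Rightarrow> nat set \<Rightarrow> 'a mpoly set" where
  "poly_ring F V = {p. coeffs_in F p \<and> vars_in V p}"

definition meval :: "('a::zero \<Rightarrow> 'b::comm_ring_1) \<Rightarrow> 'a mpoly \<Rightarrow> (nat \<Rightarrow> 'b) \<Rightarrow> 'b" where
  "meval h p z = (\<Sum>\<alpha>\<in>Poly_Mapping.keys p. h (Poly_Mapping.lookup p \<alpha>) * (\<Prod>i\<in>Poly_Mapping.keys \<alpha>. z i ^ Poly_Mapping.lookup \<alpha> i))"

definition msubst :: "'a::comm_ring_1 mpoly \<Rightarrow> (nat \<Rightarrow> 'a mpoly) \<Rightarrow> 'a mpoly" where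
  "msubst f g = meval mconst f g"

definition is_subfield :: "'b::field set \<Rightarrow> bool" where
  "is_subfield S \<longleftrightarrow> 0 \<in> S \<and> 1 \<in> S \<and> (\<forall>x\<in>S. \<forall>y\<in>S. x + y \<in> S \<and> x * y \<in> S)
      \<and> (\<forall>x\<in>S. - x \<in> S \<and> inverse x \<in> S)"

definition alg_closed_in :: "'a::field set \<Rightarrow> 'a set \<Rightarrow> bool" where
  "alg_closed_in K L \<longleftrightarrow> (\<forall>z\<in>L. (\<exists>p::'a poly. p \<noteq> 0 \<and> (\<forall>i. coeff p i \<in> K) \<and> poly p z = 0) \<longrightarrow> z \<in> K)"

definition to_frac :: "'a::field mpoly \<Rightarrow> 'a mpoly fract" where
  "to_frac p = Fract p 1"

definition gen_field :: "'a::field set \<Rightarrow> (nat \<Rightarrow> 'a mpoly) \<Rightarrow> nat \<Rightarrow> 'a mpoly fract set" where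
  "gen_field F H m = \<Inter>{S. is_subfield S \<and> (\<forall>c\<in>F. to_frac (mconst c) \<in> S)
                           \<and> (\<forall>i<m. to_frac (H i) \<in> S)}"

definition alg_indep :: "'a::field set \<Rightarrow> 'a mpoly fract set \<Rightarrow> bool" where
  "alg_indep F S \<longleftrightarrow> finite S \<and> (\<forall>e. bij_betw e {..<card S} S \<longrightarrow>
       (\<forall>f\<in>poly_ring F {..<card S}. meval (\<lambda>c. to_frac (mconst c)) f e = 0 \<longrightarrow> f = 0))"

definition trdeg_gen :: "'a::field set \<Rightarrow> (nat \<Rightarrow> 'a mpoly) \<Rightarrow> nat \<Rightarrow> nat" where
  "trdeg_gen F H m = Sup (card ` {S. S \<subseteq> gen_field F H m \<and> alg_indep F S})"

text \<open>Image apex of H = (H 0, ..., H (m-1)) \<in> 'a[x_0..x_(n-1)]^m over F.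
  The extra indeterminate t is the variable with index n.\<close>
definition image_apex :: "'a::field set \<Rightarrow> nat \<Rightarrow> nat \<Rightarrow> (nat \<Rightarrow> 'a mpoly) \<Rightarrow> (nat \<Rightarrow> 'a) \<Rightarrow> bool" where
  "image_apex F n m H a \<longleftrightarrow>
     (\<forall>f\<in>poly_ring F {..<m}. msubst f H = 0 \<longrightarrow>
        msubst f (\<lambda>i. (1 - mvar n) * H i + mvar n * mconst (a i)) = 0)"

end

theory Submission
  imports Defs
begin

text \<open>
  In characteristic zero, algebraic independence over \<open>F\<close> amounts to the existence of
  dual \<open>F\<close>-derivations, because derivations extend from subrings to fields (Zorn's lemma). The
  inequality of transcendence degrees then says that every \<open>K\<close>-derivation can be
  corrected by \<open>L\<close>-derivations so that it kills all \<open>H\<^sub>j\<close>, without changing it on \<open>L\<close>. As \<open>K\<close> is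
  algebraically closed in \<open>L\<close>, elements of \<open>L\<close> outside \<open>K\<close> are moved by such derivations, so \<open>K[H]\<close> and \<open>L\<close>,
  hence also \<open>K[H]\<close> and every extension of \<open>L\<close>, are linearly disjoint over \<open>K\<close>.

  Further, \<open>a\<close> is an image apex over \<open>F\<close> if and only if the ideal of relations of \<open>H\<close> over \<open>F\<close> is mapped
  to relations by the derivation \<open>\<Sum>\<^sub>j (a\<^sub>j - y\<^sub>j) \<partial>\<^sub>j\<close>, which is affine in \<open>a\<close>. Writing \<open>a\<close> in a basis \<open>\<mu>\<close> of the
  \<open>K\<close>-span of \<open>1, a\<^sub>1, \<dots>, a\<^sub>m\<close>, normalised to sum 1, and using linear disjointness, the condition holds for
  each component.
\<close>

text \<open>Brings the field of rational functions within reach of the extension of derivations,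
  which needs characteristic zero.\<close>

instance fract :: ("{idom, ring_char_0}") field_char_0
proof
  show "inj (of_nat :: nat \<Rightarrow> 'a fract)"
    by (rule injI) (simp add: of_nat_fract eq_fract)
qed

section \<open>Extending derivations\<close>

context
  fixes F :: "'a::field set"
  assumes F: "is_subfield F"
begin

lemma subfield_closed:
  "0 \<in> F" "1 \<in> F" "x \<in> F \<Longrightarrow> y \<in> F \<Longrightarrow> x + y \<in> F" "x \<in> F \<Longrightarrow> y \<in> F \<Longrightarrow> x * y \<in> F"
  "x \<in> F \<Longrightarrow> - x \<in> F" "x \<in> F \<Longrightarrow> inverse x \<in> F"
  "x \<in> F \<Longrightarrow> y \<in> F \<Longrightarrow> x - y \<in> F" "x \<in> F \<Longrightarrow> y \<in> F \<Longrightarrow> x / y \<in> F"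
proof -
  show *: "0 \<in> F" "1 \<in> F" "x \<in> F \<Longrightarrow> y \<in> F \<Longrightarrow> x + y \<in> F" "x \<in> F \<Longrightarrow> y \<in> F \<Longrightarrow> x * y \<in> F"
    "x \<in> F \<Longrightarrow> - x \<in> F" "x \<in> F \<Longrightarrow> inverse x \<in> F" for x y
    using F by (auto simp: is_subfield_def)
  show "x \<in> F \<Longrightarrow> y \<in> F \<Longrightarrow> x - y \<in> F" using *(3)[of x "- y"] *(5)[of y] by simp
  show "x \<in> F \<Longrightarrow> y \<in> F \<Longrightarrow> x / y \<in> F" using *(4)[of x "inverse y"] *(6)[of y]
    by (simp add: divide_inverse)
qed

lemma subfield_of_nat: "of_nat k \<in> F"
  by (induct k) (simp_all add: subfield_closed)

lemma subfield_sum: "(\<And>i. i \<in> I \<Longrightarrow> f i \<in> F) \<Longrightarrow> sum f I \<in> F"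
  by (induct I rule: infinite_finite_induct) (auto intro: subfield_closed)

lemma subfield_poly:
  assumes "\<And>i. coeff p i \<in> F" "w \<in> F"
  shows "poly p w \<in> F"
  unfolding poly_altdef
proof (rule subfield_sum)
  have "w ^ k \<in> F" for k using assms(2) by (induct k) (simp_all add: subfield_closed)
  then show "coeff p i * w ^ i \<in> F" for i using assms(1) by (intro subfield_closed(4))
qed

lemma subfield_coeff_pderiv: "(\<And>i. coeff p i \<in> F) \<Longrightarrow> coeff (pderiv p) i \<in> F"
  unfolding coeff_pderiv by (intro subfield_closed(4) subfield_of_nat)

end

section \<open>Derivations and their graphs\<close>

definition derivation_on :: "'e::comm_ring_1 set \<Rightarrow> ('e \<Rightarrow> 'e) \<Rightarrow> bool" where
  "derivation_on M D \<longleftrightarrow> (\<forall>x\<in>M. \<forall>y\<in>M. D (x + y) = D x + D y \<and> D (x * y) = x * D y + y * D x)"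

text \<open>The graph of a derivation from a subring, as a subring of the dual numbers.\<close>
definition deriv_graph :: "('e::comm_ring_1 \<times> 'e) set \<Rightarrow> bool" where
  "deriv_graph G \<longleftrightarrow> (1, 0) \<in> G
     \<and> (\<forall>x x' y y'. (x, x') \<in> G \<longrightarrow> (y, y') \<in> G \<longrightarrow>
          (x + y, x' + y') \<in> G \<and> (x * y, x * y' + y * x') \<in> G \<and> (- x, - x') \<in> G)
     \<and> (\<forall>b. (0, b) \<in> G \<longrightarrow> b = 0)"

context
  fixes G :: "('e::comm_ring_1 \<times> 'e) set"
  assumes G: "deriv_graph G"
begin

lemma deriv_graph_one: "(1, 0) \<in> G"
  using G by (simp add: deriv_graph_def)

lemma deriv_graph_add: "(x, x') \<in> G \<Longrightarrow> (y, y') \<in> G \<Longrightarrow> (x + y, x' + y') \<in> G"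
  using G unfolding deriv_graph_def by blast

lemma deriv_graph_mult: "(x, x') \<in> G \<Longrightarrow> (y, y') \<in> G \<Longrightarrow> (x * y, x * y' + y * x') \<in> G"
  using G unfolding deriv_graph_def by blast

lemma deriv_graph_uminus: "(x, x') \<in> G \<Longrightarrow> (- x, - x') \<in> G"
  using G unfolding deriv_graph_def by blast

lemma deriv_graph_diff: "(x, x') \<in> G \<Longrightarrow> (y, y') \<in> G \<Longrightarrow> (x - y, x' - y') \<in> G"
  using deriv_graph_add[of x x' "- y" "- y'"] deriv_graph_uminus[of y y'] by simp

lemma deriv_graph_zero: "(0, 0) \<in> G"
  using deriv_graph_diff[OF deriv_graph_one deriv_graph_one] by simp

lemma deriv_graph_single_valued: "(x, y) \<in> G \<Longrightarrow> (x, z) \<in> G \<Longrightarrow> y = z"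
  using deriv_graph_diff[of x y x z] G unfolding deriv_graph_def by auto

lemma deriv_graph_sum:
  "(\<And>i. i \<in> I \<Longrightarrow> (f i, g i) \<in> G) \<Longrightarrow> (sum f I, sum g I) \<in> G"
  by (induct I rule: infinite_finite_induct) (auto intro: deriv_graph_zero deriv_graph_add)

lemma deriv_graph_of_nat: "(of_nat k, 0) \<in> G"
proof (induct k)
  case (Suc k)
  then show ?case using deriv_graph_add[OF deriv_graph_one Suc] by simp
qed (simp add: deriv_graph_zero)

lemma deriv_graph_imp_derivation:
  assumes "fst ` G = M"
  shows "\<exists>D. derivation_on M D \<and> (\<forall>(x, y)\<in>G. D x = y)"
proof -
  define D where "D x = (SOME y. (x, y) \<in> G)" for x
  have D: "(x, D x) \<in> G" if "x \<in> M" for x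
    using that assms unfolding D_def by (auto intro: someI)
  have D': "D x = y" if "(x, y) \<in> G" for x y
    using deriv_graph_single_valued[OF _ that] that unfolding D_def by (meson someI)
  have "D (x + y) = D x + D y \<and> D (x * y) = x * D y + y * D x" if "x \<in> M" "y \<in> M" for x y
    using D'[OF deriv_graph_add[OF D D]] D'[OF deriv_graph_mult[OF D D]] that by blast
  then show ?thesis unfolding derivation_on_def using D' by (intro exI[of _ D]) auto
qed

end

text \<open>\<open>B\<close> stands for \<open>Q\<close> with the derivation applied to its
  coefficients; the pair is a polynomial over the subring \<open>G\<close> of the dual
  numbers.\<close>

definition pairs_in :: "('e::comm_ring_1 \<times> 'e) set \<Rightarrow> 'e poly \<Rightarrow> 'e poly \<Rightarrow> bool" where
  "pairs_in G Q B \<longleftrightarrow> (\<forall>i. (coeff Q i, coeff B i) \<in> G)"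

lemma pairs_in_mult:
  assumes "deriv_graph G" "pairs_in G Q B" "pairs_in G Q' B'"
  shows "pairs_in G (Q * Q') (Q * B' + Q' * B)"
proof -
  have "(coeff (Q * Q') i, coeff (Q * B' + Q' * B) i) \<in> G" for i
  proof -
    have "coeff (Q * B' + Q' * B) i = coeff (Q * B') i + coeff (B * Q') i"
      by (simp only: coeff_add mult.commute)
    also have "\<dots> = (\<Sum>j\<le>i. coeff Q j * coeff B' (i - j) + coeff B j * coeff Q' (i - j))"
      by (simp only: coeff_mult sum.distrib)
    also have "\<dots> = (\<Sum>j\<le>i. coeff Q j * coeff B' (i - j) + coeff Q' (i - j) * coeff B j)"
      by (intro sum.cong refl) (simp only: mult.commute)
    finally show ?thesis
      using assms unfolding coeff_mult[of Q Q'] pairs_in_def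
      by (auto intro!: deriv_graph_sum deriv_graph_mult)
  qed
  then show ?thesis by (simp add: pairs_in_def)
qed

text \<open>A derivation that sends \<open>w\<close> to \<open>u\<close> must send Q(w) to B(w) +
  Q'(w) u, where \<open>B\<close> is \<open>Q\<close> differentiated coefficientwise. The hypothesis
  on \<open>u\<close> says that polynomials vanishing at \<open>w\<close> are sent to 0, which makes
  this assignment single-valued on the ring generated by \<open>w\<close> over the domain of
  \<open>G\<close>.\<close>

lemma adjoin_deriv_graph:
  fixes G :: "('e::idom \<times> 'e) set"
  assumes G: "deriv_graph G"
    and u: "\<And>Q B. pairs_in G Q B \<Longrightarrow> poly Q w = 0 \<Longrightarrow> poly B w + poly (pderiv Q) w * u = 0"
  defines "G' \<equiv> {(poly Q w, poly B w + poly (pderiv Q) w * u) |Q B. pairs_in G Q B}"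
  shows "deriv_graph G'" "G \<subseteq> G'" "(w, u) \<in> G'"
proof -
  have I: "(poly Q w, poly B w + poly (pderiv Q) w * u) \<in> G'" if "pairs_in G Q B" for Q B
    using that unfolding G'_def by blast
  show sub: "G \<subseteq> G'"
  proof
    fix p assume p: "p \<in> G"
    obtain x y where xy: "p = (x, y)" by fastforce
    have "pairs_in G [:x:] [:y:]" unfolding pairs_in_def
      using p xy deriv_graph_zero[OF G] by (auto simp: coeff_pCons split: nat.splits)
    from I[OF this] show "p \<in> G'" using xy by simp
  qed
  have "pairs_in G [:0, 1:] 0" unfolding pairs_in_def
    using deriv_graph_zero[OF G] deriv_graph_one[OF G] by (auto simp: coeff_pCons split: nat.splits)
  from I[OF this] show "(w, u) \<in> G'" by (simp add: pderiv_pCons)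
  show "deriv_graph G'"
    unfolding deriv_graph_def
  proof (intro conjI allI impI)
    show "(1, 0) \<in> G'" using sub deriv_graph_one[OF G] by blast
    show "b = 0" if "(0, b) \<in> G'" for b using that u unfolding G'_def by force
    fix x x' y y' assume x: "(x, x') \<in> G'" and y: "(y, y') \<in> G'"
    obtain Q B where q: "x = poly Q w" "x' = poly B w + poly (pderiv Q) w * u" "pairs_in G Q B"
      using x unfolding G'_def by blast
    obtain P C where p: "y = poly P w" "y' = poly C w + poly (pderiv P) w * u" "pairs_in G P C"
      using y unfolding G'_def by blast
    have "pairs_in G (Q + P) (B + C)" using q p deriv_graph_add[OF G] by (simp add: pairs_in_def)
    from I[OF this] show "(x + y, x' + y') \<in> G'" using q p by (simp add: pderiv_add algebra_simps)
    have "pairs_in G (- Q) (- B)" using q deriv_graph_uminus[OF G] by (simp add: pairs_in_def)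
    from I[OF this] show "(- x, - x') \<in> G'" using q by (simp add: pderiv_minus algebra_simps)
    from I[OF pairs_in_mult[OF G q(3) p(3)]] show "(x * y, x * y' + y * x') \<in> G'"
      using q p by (simp add: pderiv_mult algebra_simps)
  qed
qed

text \<open>If no nonzero polynomial over the domain of \<open>G\<close> vanishes at
  \<open>w\<close>, every \<open>u\<close> is admissible. Otherwise a nonzero such polynomial of
  least degree determines \<open>u\<close>, and pseudo-division by it carries the condition over to
  all others.\<close>

lemma deriv_value_exists:
  fixes G :: "('e::field_char_0 \<times> 'e) set"
  assumes G: "deriv_graph G" and M: "is_subfield M" and "G \<subseteq> M \<times> M" and "w \<in> M"
  shows "\<exists>u\<in>M. \<forall>Q B. pairs_in G Q B \<longrightarrow> poly Q w = 0 \<longrightarrow> poly B w + poly (pderiv Q) w * u = 0"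
proof (cases "\<exists>Q B. pairs_in G Q B \<and> poly Q w = 0 \<and> Q \<noteq> 0")
  case False
  have "B = 0" if "pairs_in G 0 B" for B
    using that deriv_graph_single_valued[OF G deriv_graph_zero[OF G]] unfolding pairs_in_def
    by (intro poly_eqI) auto
  then show ?thesis using False assms(2) by (intro bexI[of _ 0]) (force simp: is_subfield_def)+
next
  case True
  define k where "k = (LEAST k. \<exists>Q B. pairs_in G Q B \<and> poly Q w = 0 \<and> Q \<noteq> 0 \<and> degree Q = k)"
  have "\<exists>Q B. pairs_in G Q B \<and> poly Q w = 0 \<and> Q \<noteq> 0 \<and> degree Q = k"
    unfolding k_def by (rule LeastI_ex) (use True in blast)
  then obtain Q0 B0 where Q0: "pairs_in G Q0 B0" "poly Q0 w = 0" "Q0 \<noteq> 0" "degree Q0 = k" by blast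
  have least: "k \<le> degree Q" if "pairs_in G Q B" "poly Q w = 0" "Q \<noteq> 0" for Q B
    unfolding k_def by (rule Least_le) (use that in blast)
  have k0: "0 < k"
  proof (rule ccontr)
    assume "\<not> 0 < k"
    then obtain c where "Q0 = [:c:]" using Q0(4) by (metis degree_eq_zeroE neq0_conv)
    then show False using Q0 by simp
  qed
  let ?d = "poly (pderiv Q0) w"
  \<comment> \<open>In characteristic zero \<open>pderiv Q0\<close> is nonzero of smaller degree,
    with coefficients again in the domain of \<open>G\<close>, so a root at \<open>w\<close> would
    contradict minimality.\<close>
  have d0: "?d \<noteq> 0"
  proof
    assume d: "?d = 0"
    have "pairs_in G (pderiv Q0) (pderiv B0)" unfolding pairs_in_def coeff_pderiv
    proof
      fix n
      have "(coeff Q0 (Suc n), coeff B0 (Suc n)) \<in> G" using Q0 by (simp add: pairs_in_def)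
      from deriv_graph_mult[OF G deriv_graph_of_nat[OF G, of "Suc n"] this]
      show "(of_nat (Suc n) * coeff Q0 (Suc n), of_nat (Suc n) * coeff B0 (Suc n)) \<in> G" by simp
    qed
    moreover have "pderiv Q0 \<noteq> 0" using k0 Q0(4) pderiv_eq_0_iff[of Q0] by auto
    ultimately have "k \<le> degree (pderiv Q0)" using least d by blast
    then show False using k0 Q0(4) by (simp add: degree_pderiv)
  qed
  \<comment> \<open>The only value for which the condition holds for \<open>Q0\<close>
    itself.\<close>
  define u where "u = - poly B0 w / ?d"
  have "coeff Q0 i \<in> M" "coeff B0 i \<in> M" for i
    using Q0(1) assms(3) by (auto simp: pairs_in_def)
  then have "poly B0 w \<in> M" "?d \<in> M"
    using assms(4) by (auto intro!: subfield_poly[OF M] subfield_coeff_pderiv[OF M])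
  then have uM: "u \<in> M" unfolding u_def by (intro subfield_closed[OF M])
  have u0: "poly B0 w + ?d * u = 0" using d0 by (simp add: u_def)
  have main: "poly B w + poly (pderiv Q) w * u = 0" if "pairs_in G Q B" "poly Q w = 0" for Q B
    using that
  proof (induct "degree Q" arbitrary: Q B rule: less_induct)
    case less
    show ?case
    proof (cases "Q = 0")
      case True
      then have "B = 0" using less(2) deriv_graph_single_valued[OF G deriv_graph_zero[OF G]]
        unfolding pairs_in_def by (intro poly_eqI) auto
      then show ?thesis using True by simp
    next
      case False
      have kd: "k \<le> degree Q" using least less False by blast
      define c where "c = coeff Q0 k"
      define c' where "c' = coeff B0 k"
      define e where "e = coeff Q (degree Q)"
      define e' where "e' = coeff B (degree Q)"
      define j where "j = degree Q - k"
      have c: "(c, c') \<in> G" and e: "(e, e') \<in> G" using Q0(1) less(2)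
        by (auto simp: pairs_in_def c_def c'_def e_def e'_def)
      have c0: "c \<noteq> 0" using Q0 by (auto simp: c_def)
      have *: "pairs_in G [:c:] [:c':]" using c deriv_graph_zero[OF G]
        by (auto simp: pairs_in_def coeff_pCons split: nat.splits)
      have **: "pairs_in G (monom e j) (monom e' j)" using e deriv_graph_zero[OF G]
        by (auto simp: pairs_in_def)
      \<comment> \<open>Cross-multiplying by the leading coefficients \<open>c\<close> and
        \<open>e\<close> cancels the top term without division, as the domain of \<open>G\<close> is
        only a ring. \<open>B1\<close> is the matching coefficientwise derivative.\<close>
      define Q1 where "Q1 = [:c:] * Q - monom e j * Q0"
      define B1 where "B1 = ([:c:] * B + Q * [:c':]) - (monom e j * B0 + Q0 * monom e' j)"
      have p1: "pairs_in G Q1 B1"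
        using pairs_in_mult[OF G * less(2)] pairs_in_mult[OF G ** Q0(1)] deriv_graph_diff[OF G]
        unfolding pairs_in_def Q1_def B1_def by simp
      have r1: "poly Q1 w = 0" using less(3) Q0(2) by (simp add: Q1_def)
      \<comment> \<open>The further product rule terms carry a factor Q(w) or Q0(w) and vanish. With
        \<open>u0\<close> and c \<noteq> 0 the claim for \<open>Q1\<close> gives the claim for
        \<open>Q\<close>.\<close>
      have ev: "poly B1 w + poly (pderiv Q1) w * u = c * (poly B w + poly (pderiv Q) w * u)
         - poly (monom e j) w * (poly B0 w + ?d * u)"
        using less(3) Q0(2) unfolding Q1_def B1_def
        by (simp add: pderiv_diff pderiv_mult pderiv_smult algebra_simps)
      have "poly B1 w + poly (pderiv Q1) w * u = 0"
      proof (cases "Q1 = 0")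
        case True
        then have "B1 = 0" using p1 deriv_graph_single_valued[OF G deriv_graph_zero[OF G]]
          unfolding pairs_in_def by (intro poly_eqI) auto
        then show ?thesis using True by simp
      next
        case False
        have "degree Q1 \<le> degree Q"
          unfolding Q1_def
        proof (intro degree_diff_le)
          show "degree ([:c:] * Q) \<le> degree Q" by (simp add: degree_smult_le)
          have "degree (monom e j * Q0) \<le> degree (monom e j) + degree Q0" by (rule degree_mult_le)
          also have "\<dots> \<le> j + k" using degree_monom_le[of e j] Q0(4) by simp
          finally show "degree (monom e j * Q0) \<le> degree Q" using kd by (simp add: j_def)
        qed
        moreover have "coeff Q1 (degree Q) = 0" using kd
          by (simp add: Q1_def c_def e_def j_def coeff_monom_mult)
        ultimately have "degree Q1 < degree Q" using False
          by (metis eq_zero_or_degree_less)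
        then show ?thesis using less(1) p1 r1 by blast
      qed
      then show ?thesis using ev u0 c0 by simp
    qed
  qed
  show ?thesis using uM main by blast
qed

text \<open>Zorn's lemma gives a maximal graph inside M \<times> M that contains \<open>G0\<close>.
  By the two preceding lemmas any element of \<open>M\<close> could be adjoined to it, so its domain
  is already all of \<open>M\<close>.\<close>

lemma derivation_extension:
  fixes G0 :: "('e::field_char_0 \<times> 'e) set"
  assumes G0: "deriv_graph G0" and M: "is_subfield M" and "G0 \<subseteq> M \<times> M"
  shows "\<exists>D. derivation_on M D \<and> D ` M \<subseteq> M \<and> (\<forall>(x, y)\<in>G0. D x = y)"
proof -
  let ?A = "{G. deriv_graph G \<and> G0 \<subseteq> G \<and> G \<subseteq> M \<times> M}"
  have "\<exists>X\<in>?A. \<forall>Y\<in>?A. X \<subseteq> Y \<longrightarrow> Y = X"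
  proof (rule subset_Zorn_nonempty)
    show "?A \<noteq> {}" using assms by blast
    fix C assume C0: "C \<noteq> {}" and C: "subset.chain ?A C"
    have CA: "C \<subseteq> ?A" using C by (simp add: subset.chain_def)
    have "deriv_graph (\<Union>C)"
      unfolding deriv_graph_def
    proof (intro conjI allI impI)
      show "(1, 0) \<in> \<Union>C" using C0 CA deriv_graph_one by blast
      show "b = 0" if "(0, b) \<in> \<Union>C" for b using that CA by (auto simp: deriv_graph_def)
      fix x x' y y' assume x: "(x, x') \<in> \<Union>C" and y: "(y, y') \<in> \<Union>C"
      obtain X Y where "X \<in> C" "Y \<in> C" "(x, x') \<in> X" "(y, y') \<in> Y" using x y by blast
      moreover have "X \<subseteq> Y \<or> Y \<subseteq> X" using C calculation by (metis subset_chain_def)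
      ultimately obtain Z where Z: "Z \<in> C" "(x, x') \<in> Z" "(y, y') \<in> Z" by blast
      then have g: "deriv_graph Z" using CA by blast
      show "(x + y, x' + y') \<in> \<Union>C" using deriv_graph_add[OF g] Z by blast
      show "(x * y, x * y' + y * x') \<in> \<Union>C" using deriv_graph_mult[OF g] Z by blast
      show "(- x, - x') \<in> \<Union>C" using deriv_graph_uminus[OF g] Z by blast
    qed
    then show "\<Union>C \<in> ?A" using C0 CA by blast
  qed
  then obtain G where "G \<in> ?A" and max': "\<forall>Y\<in>?A. G \<subseteq> Y \<longrightarrow> Y = G" by (elim bexE)
  then have G: "deriv_graph G" "G0 \<subseteq> G" "G \<subseteq> M \<times> M" by simp_all
  have max: "Y = G" if "deriv_graph Y" "Y \<subseteq> M \<times> M" "G \<subseteq> Y" for Y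
    using max' that order.trans[OF G(2) that(3)] by simp
  have "w \<in> fst ` G" if w: "w \<in> M" for w
  proof -
    obtain u where uM: "u \<in> M"
      and u: "\<And>Q B. pairs_in G Q B \<Longrightarrow> poly Q w = 0 \<Longrightarrow> poly B w + poly (pderiv Q) w * u = 0"
      using deriv_value_exists[OF G(1) M G(3) w] by blast
    define G' where "G' = {(poly Q w, poly B w + poly (pderiv Q) w * u) |Q B. pairs_in G Q B}"
    note adj = adjoin_deriv_graph[OF G(1) u, folded G'_def]
    have "G' \<subseteq> M \<times> M"
    proof
      fix p assume "p \<in> G'"
      then obtain Q B where p: "p = (poly Q w, poly B w + poly (pderiv Q) w * u)" "pairs_in G Q B"
        unfolding G'_def by blast
      have "coeff Q i \<in> M" "coeff B i \<in> M" for i using p G(3) by (auto simp: pairs_in_def)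
      then have "poly Q w \<in> M" "poly B w \<in> M" "poly (pderiv Q) w \<in> M"
        using w by (auto intro!: subfield_poly[OF M] subfield_coeff_pderiv[OF M])
      then show "p \<in> M \<times> M" using p uM by (simp add: subfield_closed[OF M])
    qed
    then have "G' = G" using max adj by blast
    then show ?thesis using adj(3) by force
  qed
  then have fG: "fst ` G = M" using G(3) by force
  obtain D where D: "derivation_on M D" "\<forall>(x, y)\<in>G. D x = y"
    using deriv_graph_imp_derivation[OF G(1) fG] by blast
  have "D ` M \<subseteq> M" using D(2) G(3) fG by fastforce
  moreover have "\<forall>p\<in>G0. case p of (x, y) \<Rightarrow> D x = y" using D(2) G(2) by (meson subsetD)
  ultimately show ?thesis using D(1) by (intro exI[of _ D] conjI)
qed

section \<open>Evaluation of multivariate polynomials\<close>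

definition monomial_value :: "(nat \<Rightarrow>\<^sub>0 nat) \<Rightarrow> (nat \<Rightarrow> 'b::comm_ring_1) \<Rightarrow> 'b" where
  "monomial_value \<alpha> z = (\<Prod>i\<in>Poly_Mapping.keys \<alpha>. z i ^ Poly_Mapping.lookup \<alpha> i)"

definition is_hom :: "('a::comm_ring_1 \<Rightarrow> 'b::comm_ring_1) \<Rightarrow> bool" where
  "is_hom h \<longleftrightarrow> h 1 = 1 \<and> (\<forall>x y. h (x + y) = h x + h y \<and> h (x * y) = h x * h y)"

lemma monomial_value_superset:
  assumes "finite V" "Poly_Mapping.keys \<alpha> \<subseteq> V"
  shows "monomial_value \<alpha> z = (\<Prod>i\<in>V. z i ^ Poly_Mapping.lookup \<alpha> i)"
  unfolding monomial_value_def
  by (rule prod.mono_neutral_left) (use assms in \<open>auto simp: in_keys_iff\<close>)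

lemma monomial_value_add: "monomial_value (\<alpha> + \<beta>) z = monomial_value \<alpha> z * monomial_value \<beta> z"
proof -
  let ?V = "Poly_Mapping.keys \<alpha> \<union> Poly_Mapping.keys \<beta>"
  have V: "finite ?V" "Poly_Mapping.keys (\<alpha> + \<beta>) \<subseteq> ?V" by (simp_all add: keys_add)
  show ?thesis
    using monomial_value_superset[of ?V \<alpha> z] monomial_value_superset[of ?V \<beta> z]
      monomial_value_superset[OF V, of z]
    by (simp add: lookup_add power_add prod.distrib)
qed

lemma monomial_value_zero [simp]: "monomial_value 0 z = 1"
  by (simp add: monomial_value_def)

lemma monomial_value_single: "monomial_value (Poly_Mapping.single i k) z = z i ^ k"
  by (simp add: monomial_value_def)

lemma is_hom_zero: "is_hom h \<Longrightarrow> h 0 = 0"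
  unfolding is_hom_def by (metis add_cancel_right_right)

lemma is_hom_one: "is_hom h \<Longrightarrow> h 1 = 1"
  and is_hom_add: "is_hom h \<Longrightarrow> h (x + y) = h x + h y"
  and is_hom_mult: "is_hom h \<Longrightarrow> h (x * y) = h x * h y"
  by (simp_all add: is_hom_def)

lemma is_hom_uminus: "is_hom h \<Longrightarrow> h (- x) = - h x"
  using is_hom_add[of h "- x" x] is_hom_zero[of h] by (simp add: eq_neg_iff_add_eq_0)

lemma is_hom_diff: "is_hom h \<Longrightarrow> h (x - y) = h x - h y"
  using is_hom_add[of h x "- y"] is_hom_uminus[of h y] by simp

lemma is_hom_sum: "is_hom h \<Longrightarrow> h (sum f A) = (\<Sum>x\<in>A. h (f x))"
  by (induct A rule: infinite_finite_induct) (simp_all add: is_hom_zero is_hom_add)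

lemma is_hom_power: "is_hom h \<Longrightarrow> h (x ^ k) = h x ^ k"
  by (induct k) (simp_all add: is_hom_one is_hom_mult)

lemma is_hom_prod: "is_hom h \<Longrightarrow> h (prod f A) = (\<Prod>x\<in>A. h (f x))"
  by (induct A rule: infinite_finite_induct) (simp_all add: is_hom_one is_hom_mult)

lemma is_hom_comp: "is_hom g \<Longrightarrow> is_hom h \<Longrightarrow> is_hom (\<lambda>x. g (h x))"
  by (simp add: is_hom_def)

lemma is_hom_mconst: "is_hom mconst"
  by (simp add: is_hom_def mconst_def single_add mult_single)

lemma is_hom_pCons_zero: "is_hom (\<lambda>c. [:c:])"
  by (simp add: is_hom_def)

lemma is_hom_poly: "is_hom (\<lambda>p. poly p x)"
  by (simp add: is_hom_def)

lemma meval_eq: "meval h p z = (\<Sum>\<alpha>\<in>Poly_Mapping.keys p. h (Poly_Mapping.lookup p \<alpha>) * monomial_value \<alpha> z)"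
  by (simp add: meval_def monomial_value_def)

lemma meval_superset:
  assumes "h 0 = 0" "finite A" "Poly_Mapping.keys p \<subseteq> A"
  shows "meval h p z = (\<Sum>\<alpha>\<in>A. h (Poly_Mapping.lookup p \<alpha>) * monomial_value \<alpha> z)"
  unfolding meval_eq
  by (rule sum.mono_neutral_left) (use assms in \<open>auto simp: in_keys_iff\<close>)

lemma meval_add:
  assumes "is_hom h"
  shows "meval h (p + q) z = meval h p z + meval h q z"
proof -
  let ?A = "Poly_Mapping.keys p \<union> Poly_Mapping.keys q"
  have A: "finite ?A" "Poly_Mapping.keys (p + q) \<subseteq> ?A" by (simp_all add: keys_add)
  note h0 = is_hom_zero[OF assms]
  show ?thesis
    using meval_superset[of h ?A "p + q" z] A meval_superset[of h ?A p z] meval_superset[of h ?A q z] h0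
    by (simp add: lookup_add is_hom_add[OF assms] sum.distrib algebra_simps)
qed

lemma meval_zero [simp]: "meval h 0 z = 0"
  by (simp add: meval_eq)

lemma meval_single: "is_hom h \<Longrightarrow> meval h (Poly_Mapping.single \<alpha> c) z = h c * monomial_value \<alpha> z"
  by (cases "c = 0") (simp_all add: meval_eq is_hom_zero)

lemma meval_mconst: "is_hom h \<Longrightarrow> meval h (mconst c) z = h c"
  by (simp add: mconst_def meval_single)

lemma meval_mvar: "is_hom h \<Longrightarrow> meval h (mvar i) z = z i"
  by (simp add: mvar_def meval_single monomial_value_single is_hom_one)

lemma meval_sum: "is_hom h \<Longrightarrow> meval h (sum f A) z = (\<Sum>x\<in>A. meval h (f x) z)"
  by (induct A rule: infinite_finite_induct) (simp_all add: meval_add)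

lemma poly_mapping_eq_sum_single:
  "p = (\<Sum>\<alpha>\<in>Poly_Mapping.keys p. Poly_Mapping.single \<alpha> (Poly_Mapping.lookup p \<alpha>))"
proof (rule poly_mapping_eqI)
  fix \<beta>
  show "Poly_Mapping.lookup p \<beta> =
    Poly_Mapping.lookup (\<Sum>\<alpha>\<in>Poly_Mapping.keys p. Poly_Mapping.single \<alpha> (Poly_Mapping.lookup p \<alpha>)) \<beta>"
    by (cases "\<beta> \<in> Poly_Mapping.keys p")
      (simp_all add: lookup_sum lookup_single when_def in_keys_iff)
qed

lemma meval_mult:
  assumes "is_hom h"
  shows "meval h (p * q) z = meval h p z * meval h q z"
proof -
  let ?s = "\<lambda>p \<alpha>. Poly_Mapping.single \<alpha> (Poly_Mapping.lookup p \<alpha>)"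
  have "p * q = (\<Sum>\<alpha>\<in>Poly_Mapping.keys p. \<Sum>\<beta>\<in>Poly_Mapping.keys q. ?s p \<alpha> * ?s q \<beta>)"
    by (subst poly_mapping_eq_sum_single[of p], subst poly_mapping_eq_sum_single[of q])
      (rule sum_product)
  then have "meval h (p * q) z = (\<Sum>\<alpha>\<in>Poly_Mapping.keys p. \<Sum>\<beta>\<in>Poly_Mapping.keys q.
      (h (Poly_Mapping.lookup p \<alpha>) * monomial_value \<alpha> z)
      * (h (Poly_Mapping.lookup q \<beta>) * monomial_value \<beta> z))"
    by (simp add: mult_single meval_sum[OF assms] meval_single[OF assms] is_hom_mult[OF assms]
        monomial_value_add ac_simps)
  then show ?thesis by (simp add: meval_eq sum_product)
qed

lemma is_hom_meval: "is_hom h \<Longrightarrow> is_hom (\<lambda>p. meval h p z)"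
  using meval_mconst[of h 1 z]
  by (simp add: is_hom_def meval_add meval_mult mconst_def)

lemma hom_meval:
  assumes "is_hom \<phi>" "is_hom h"
  shows "\<phi> (meval h p z) = meval (\<lambda>c. \<phi> (h c)) p (\<lambda>i. \<phi> (z i))"
  by (simp add: meval_eq monomial_value_def is_hom_sum[OF assms(1)] is_hom_mult[OF assms(1)]
      is_hom_prod[OF assms(1)] is_hom_power[OF assms(1)])

lemma meval_cong_vars:
  assumes "vars_in V p" "\<And>i. i \<in> V \<Longrightarrow> z i = z' i"
  shows "meval h p z = meval h p z'"
proof -
  have "monomial_value \<alpha> z = monomial_value \<alpha> z'" if "\<alpha> \<in> Poly_Mapping.keys p" for \<alpha>
  proof -
    have "Poly_Mapping.keys \<alpha> \<subseteq> V" using that assms(1) by (simp add: vars_in_def)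
    then show ?thesis unfolding monomial_value_def using assms(2) by (intro prod.cong) auto
  qed
  then show ?thesis by (simp add: meval_eq)
qed

lemma meval_mvar_id:
  fixes p :: "'a::comm_ring_1 mpoly"
  shows "meval mconst p mvar = p"
proof -
  have *: "mvar i ^ k = Poly_Mapping.single (Poly_Mapping.single i k) (1::'a)" for i k
    by (induct k) (simp_all add: mvar_def mult_single single_add[symmetric])
  have **: "monomial_value \<alpha> mvar = Poly_Mapping.single \<alpha> (1::'a)" for \<alpha>
  proof -
    have "(\<Prod>i\<in>A. Poly_Mapping.single (Poly_Mapping.single i (Poly_Mapping.lookup \<alpha> i)) 1)
      = Poly_Mapping.single (\<Sum>i\<in>A. Poly_Mapping.single i (Poly_Mapping.lookup \<alpha> i)) (1::'a)" for A
      by (induct A rule: infinite_finite_induct) (simp_all add: mult_single)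
    from this[of "Poly_Mapping.keys \<alpha>"] show ?thesis
      by (simp only: monomial_value_def * poly_mapping_eq_sum_single[of \<alpha>, symmetric])
  qed
  show ?thesis
    using poly_mapping_eq_sum_single[of p] by (simp add: meval_eq ** mconst_def mult_single)
qed

lemma poly_ringD:
  "p \<in> poly_ring F V \<Longrightarrow> \<alpha> \<in> Poly_Mapping.keys p \<Longrightarrow> Poly_Mapping.lookup p \<alpha> \<in> F"
  "p \<in> poly_ring F V \<Longrightarrow> \<alpha> \<in> Poly_Mapping.keys p \<Longrightarrow> Poly_Mapping.keys \<alpha> \<subseteq> V"
  "p \<in> poly_ring F V \<Longrightarrow> vars_in V p"
  by (auto simp: poly_ring_def coeffs_in_def vars_in_def)

lemma single_in_poly_ring: "c \<in> F \<Longrightarrow> Poly_Mapping.keys \<alpha> \<subseteq> V \<Longrightarrow> Poly_Mapping.single \<alpha> c \<in> poly_ring F V"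
  by (auto simp: poly_ring_def coeffs_in_def vars_in_def)

context
  fixes F :: "'a::field set"
  assumes F: "is_subfield F"
begin

lemma poly_ring_iff:
  "p \<in> poly_ring F V \<longleftrightarrow> (\<forall>\<alpha>. Poly_Mapping.lookup p \<alpha> \<in> F) \<and> vars_in V p"
  using subfield_closed(1)[OF F] by (auto simp: poly_ring_def coeffs_in_def in_keys_iff)

lemma poly_ring_add:
  "p \<in> poly_ring F V \<Longrightarrow> q \<in> poly_ring F V \<Longrightarrow> p + q \<in> poly_ring F V"
  using subsetD[OF keys_add[of p q]] unfolding poly_ring_iff vars_in_def
  by (simp add: lookup_add subfield_closed(3)[OF F]) blast

lemma poly_ring_uminus: "p \<in> poly_ring F V \<Longrightarrow> - p \<in> poly_ring F V"
  unfolding poly_ring_iff vars_in_def in_keys_iff by (auto intro: subfield_closed[OF F])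

lemma poly_ring_sum:
  "(\<And>i. i \<in> I \<Longrightarrow> f i \<in> poly_ring F V) \<Longrightarrow> sum f I \<in> poly_ring F V"
proof -
  have "0 \<in> poly_ring F V" by (simp add: poly_ring_def coeffs_in_def vars_in_def)
  then show "(\<And>i. i \<in> I \<Longrightarrow> f i \<in> poly_ring F V) \<Longrightarrow> sum f I \<in> poly_ring F V"
    by (induct I rule: infinite_finite_induct) (simp_all add: poly_ring_add)
qed

lemma poly_ring_mult:
  assumes "p \<in> poly_ring F V" "q \<in> poly_ring F V"
  shows "p * q \<in> poly_ring F V"
proof -
  let ?s = "\<lambda>p \<alpha>. Poly_Mapping.single \<alpha> (Poly_Mapping.lookup p \<alpha>)"
  have "p * q = (\<Sum>\<alpha>\<in>Poly_Mapping.keys p. \<Sum>\<beta>\<in>Poly_Mapping.keys q. ?s p \<alpha> * ?s q \<beta>)"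
    by (subst poly_mapping_eq_sum_single[of p], subst poly_mapping_eq_sum_single[of q])
      (rule sum_product)
  also have "\<dots> \<in> poly_ring F V"
  proof (intro poly_ring_sum)
    fix \<alpha> \<beta> assume "\<alpha> \<in> Poly_Mapping.keys p" "\<beta> \<in> Poly_Mapping.keys q"
    then show "?s p \<alpha> * ?s q \<beta> \<in> poly_ring F V"
      using poly_ringD(1,2)[OF assms(1), of \<alpha>] poly_ringD(1,2)[OF assms(2), of \<beta>]
        order.trans[OF keys_add[of \<alpha> \<beta>]] unfolding mult_single
      by (intro single_in_poly_ring subfield_closed[OF F]) auto
  qed
  finally show ?thesis .
qed

lemma mconst_in_poly_ring: "c \<in> F \<Longrightarrow> mconst c \<in> poly_ring F V"
  unfolding mconst_def by (rule single_in_poly_ring) simp_all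

lemma mvar_in_poly_ring: "i \<in> V \<Longrightarrow> mvar i \<in> poly_ring F V"
  unfolding mvar_def by (rule single_in_poly_ring) (simp_all add: subfield_closed[OF F])

end

section \<open>Partial derivatives and the chain rule\<close>

text \<open>The subtraction of exponents is truncated, which is harmless: where the variable
  \<open>j\<close> is missing from \<alpha>, the coefficient is 0.\<close>

definition mpderiv :: "nat \<Rightarrow> 'a::comm_ring_1 mpoly \<Rightarrow> 'a mpoly" where
  "mpderiv j p = (\<Sum>\<alpha>\<in>Poly_Mapping.keys p.
     Poly_Mapping.single (\<alpha> - Poly_Mapping.single j 1)
       (of_nat (Poly_Mapping.lookup \<alpha> j) * Poly_Mapping.lookup p \<alpha>))"

lemma lookup_mpderiv:
  "Poly_Mapping.lookup (mpderiv j p) \<beta> =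
     of_nat (Suc (Poly_Mapping.lookup \<beta> j)) * Poly_Mapping.lookup p (\<beta> + Poly_Mapping.single j 1)"
proof -
  let ?e = "Poly_Mapping.single j 1 :: nat \<Rightarrow>\<^sub>0 nat"
  let ?c = "\<lambda>\<alpha>. of_nat (Poly_Mapping.lookup \<alpha> j) * Poly_Mapping.lookup p \<alpha>"
  have eq: "\<alpha> = \<beta> + ?e" if "\<alpha> - ?e = \<beta>" "Poly_Mapping.lookup \<alpha> j \<noteq> 0" for \<alpha>
    using that by (intro poly_mapping_eqI) (auto simp: lookup_add lookup_minus lookup_single when_def)
  have "Poly_Mapping.lookup (mpderiv j p) \<beta> =
      (\<Sum>\<alpha>\<in>Poly_Mapping.keys p. if \<alpha> = \<beta> + ?e then ?c \<alpha> else 0)"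
    unfolding mpderiv_def lookup_sum
  proof (rule sum.cong[OF refl])
    fix \<alpha>
    show "Poly_Mapping.lookup (Poly_Mapping.single (\<alpha> - ?e) (?c \<alpha>)) \<beta> = (if \<alpha> = \<beta> + ?e then ?c \<alpha> else 0)"
    proof (cases "\<alpha> = \<beta> + ?e")
      case False
      then show ?thesis using eq[of \<alpha>] by (cases "Poly_Mapping.lookup \<alpha> j = 0") (auto simp: lookup_single when_def)
    qed simp
  qed
  also have "\<dots> = ?c (\<beta> + ?e)" by (auto simp: in_keys_iff)
  also have "\<dots> = of_nat (Suc (Poly_Mapping.lookup \<beta> j)) * Poly_Mapping.lookup p (\<beta> + ?e)"
    by (simp add: lookup_add)
  finally show ?thesis .
qed

lemma mpderiv_in_poly_ring:
  assumes "is_subfield F" "p \<in> poly_ring F V"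
  shows "mpderiv j p \<in> poly_ring F V"
  unfolding mpderiv_def
proof (intro poly_ring_sum[OF assms(1)] single_in_poly_ring)
  fix \<alpha> assume \<alpha>: "\<alpha> \<in> Poly_Mapping.keys p"
  show "of_nat (Poly_Mapping.lookup \<alpha> j) * Poly_Mapping.lookup p \<alpha> \<in> F"
    using \<alpha> assms by (intro subfield_closed subfield_of_nat poly_ringD)
  have "Poly_Mapping.keys (\<alpha> - Poly_Mapping.single j 1) \<subseteq> Poly_Mapping.keys \<alpha>"
    by (auto simp: in_keys_iff lookup_minus)
  then show "Poly_Mapping.keys (\<alpha> - Poly_Mapping.single j 1) \<subseteq> V"
    using poly_ringD(2)[OF assms(2) \<alpha>] by blast
qed

abbreviation derivation :: "('e::comm_ring_1 \<Rightarrow> 'e) \<Rightarrow> bool" where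
  "derivation D \<equiv> derivation_on UNIV D"

lemma derivation_add: "derivation D \<Longrightarrow> D (x + y) = D x + D y"
  and derivation_mult: "derivation D \<Longrightarrow> D (x * y) = x * D y + y * D x"
  by (simp_all add: derivation_on_def)

lemma derivation_zero: "derivation D \<Longrightarrow> D 0 = 0"
  using derivation_add[of D 0 0] by simp

lemma derivation_one: "derivation D \<Longrightarrow> D 1 = 0"
  using derivation_mult[of D 1 1] by simp

lemma derivation_uminus: "derivation D \<Longrightarrow> D (- x) = - D x"
  using derivation_add[of D "- x" x] derivation_zero[of D] by (simp add: eq_neg_iff_add_eq_0)

lemma derivation_sum: "derivation D \<Longrightarrow> D (sum f A) = (\<Sum>x\<in>A. D (f x))"
  by (induct A rule: infinite_finite_induct) (simp_all add: derivation_zero derivation_add)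

lemma derivation_power: "derivation D \<Longrightarrow> D (x ^ k) = of_nat k * x ^ (k - 1) * D x"
proof (induct k)
  case (Suc k)
  then show ?case by (cases k) (simp_all add: derivation_mult algebra_simps)
qed (simp add: derivation_one)

lemma derivation_prod:
  assumes "derivation D" "finite A"
  shows "D (prod f A) = (\<Sum>j\<in>A. D (f j) * prod f (A - {j}))"
  using assms(2)
proof (induct A)
  case (insert a A)
  have "(\<Sum>j\<in>A. D (f j) * prod f (insert a A - {j})) = f a * (\<Sum>j\<in>A. D (f j) * prod f (A - {j}))"
    unfolding sum_distrib_left
  proof (rule sum.cong[OF refl])
    fix j assume "j \<in> A"
    then have "insert a A - {j} = insert a (A - {j})" using insert by auto
    then show "D (f j) * prod f (insert a A - {j}) = f a * (D (f j) * prod f (A - {j}))"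
      using insert by simp
  qed
  moreover have "insert a A - {a} = A" using insert by auto
  ultimately show ?case using insert by (simp add: derivation_mult[OF assms(1)] algebra_simps)
qed (simp add: derivation_one[OF assms(1)])

text \<open>As \<open>D\<close> kills the coefficients, only the monomials are differentiated. A
  general \<open>h\<close> lets the rule serve both for derivations of the rational function field
  and for \<open>pderiv\<close> on polynomials in t.\<close>

lemma chain_rule:
  assumes h: "is_hom h" and D: "derivation D" and V: "finite V" "vars_in V p"
    and D0: "\<And>\<alpha>. D (h (Poly_Mapping.lookup p \<alpha>)) = 0"
  shows "D (meval h p z) = (\<Sum>j\<in>V. meval h (mpderiv j p) z * D (z j))"
proof -
  let ?e = "\<lambda>j. Poly_Mapping.single j 1 :: nat \<Rightarrow>\<^sub>0 nat"
  have mono: "D (monomial_value \<alpha> z) =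
      (\<Sum>j\<in>V. of_nat (Poly_Mapping.lookup \<alpha> j) * monomial_value (\<alpha> - ?e j) z * D (z j))"
    if \<alpha>: "\<alpha> \<in> Poly_Mapping.keys p" for \<alpha>
  proof -
    have kV: "Poly_Mapping.keys \<alpha> \<subseteq> V" using \<alpha> V(2) by (auto simp: vars_in_def)
    have "D (monomial_value \<alpha> z) = (\<Sum>j\<in>V. D (z j ^ Poly_Mapping.lookup \<alpha> j)
        * (\<Prod>i\<in>V - {j}. z i ^ Poly_Mapping.lookup \<alpha> i))"
      unfolding monomial_value_superset[OF V(1) kV] by (rule derivation_prod[OF D V(1)])
    also have "\<dots> = (\<Sum>j\<in>V. of_nat (Poly_Mapping.lookup \<alpha> j) * monomial_value (\<alpha> - ?e j) z * D (z j))"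
    proof (rule sum.cong[OF refl])
      fix j assume j: "j \<in> V"
      have k: "Poly_Mapping.keys (\<alpha> - ?e j) \<subseteq> V"
        using kV by (auto simp: in_keys_iff lookup_minus)
      have "monomial_value (\<alpha> - ?e j) z = z j ^ (Poly_Mapping.lookup \<alpha> j - 1)
          * (\<Prod>i\<in>V - {j}. z i ^ Poly_Mapping.lookup (\<alpha> - ?e j) i)"
        unfolding monomial_value_superset[OF V(1) k] prod.remove[OF V(1) j]
        by (simp add: lookup_minus)
      also have "(\<Prod>i\<in>V - {j}. z i ^ Poly_Mapping.lookup (\<alpha> - ?e j) i)
          = (\<Prod>i\<in>V - {j}. z i ^ Poly_Mapping.lookup \<alpha> i)"
        by (intro prod.cong) (auto simp: lookup_minus lookup_single when_def)
      finally show "D (z j ^ Poly_Mapping.lookup \<alpha> j) * (\<Prod>i\<in>V - {j}. z i ^ Poly_Mapping.lookup \<alpha> i)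
          = of_nat (Poly_Mapping.lookup \<alpha> j) * monomial_value (\<alpha> - ?e j) z * D (z j)"
        by (simp add: derivation_power[OF D] ac_simps)
    qed
    finally show ?thesis .
  qed
  have hn: "h (of_nat k) = of_nat k" for k
    by (induct k) (simp_all add: is_hom_zero[OF h] is_hom_one[OF h] is_hom_add[OF h])
  have "D (meval h p z) = (\<Sum>\<alpha>\<in>Poly_Mapping.keys p. h (Poly_Mapping.lookup p \<alpha>) * D (monomial_value \<alpha> z))"
    by (simp add: meval_eq derivation_sum[OF D] derivation_mult[OF D] D0)
  also have "\<dots> = (\<Sum>\<alpha>\<in>Poly_Mapping.keys p. \<Sum>j\<in>V. h (Poly_Mapping.lookup p \<alpha>)
      * (of_nat (Poly_Mapping.lookup \<alpha> j) * monomial_value (\<alpha> - ?e j) z * D (z j)))"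
    by (intro sum.cong refl) (simp add: mono sum_distrib_left)
  also have "\<dots> = (\<Sum>j\<in>V. \<Sum>\<alpha>\<in>Poly_Mapping.keys p. h (Poly_Mapping.lookup p \<alpha>)
      * (of_nat (Poly_Mapping.lookup \<alpha> j) * monomial_value (\<alpha> - ?e j) z * D (z j)))"
    by (rule sum.swap)
  also have "\<dots> = (\<Sum>j\<in>V. meval h (mpderiv j p) z * D (z j))"
    by (intro sum.cong refl)
      (simp add: mpderiv_def meval_sum[OF h] meval_single[OF h] is_hom_mult[OF h] hn
        sum_distrib_left sum_distrib_right ac_simps)
  finally show ?thesis .
qed

section \<open>Transcendence degree through derivations\<close>

text \<open>Gaussian elimination, one equation at a time; \<open>J\<close> indexes the equations and
  \<open>I\<close> the unknowns.\<close>

lemma homogeneous_system_solvable: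
  fixes v :: "'i \<Rightarrow> 'j \<Rightarrow> 'e::field"
  assumes "finite J" "finite I" "card J < card I"
  shows "\<exists>c. (\<exists>i\<in>I. c i \<noteq> 0) \<and> (\<forall>j\<in>J. (\<Sum>i\<in>I. c i * v i j) = 0)"
  using assms
proof (induct J arbitrary: I v rule: finite_induct)
  case empty
  then have "I \<noteq> {}" by auto
  then show ?case by (intro exI[of _ "\<lambda>_. 1"]) auto
next
  case (insert j0 J)
  show ?case
  proof (cases "\<forall>i\<in>I. v i j0 = 0")
    case True
    have "card J < card I" using insert by simp
    then obtain c where "\<exists>i\<in>I. c i \<noteq> 0" "\<forall>j\<in>J. (\<Sum>i\<in>I. c i * v i j) = 0"
      using insert(3)[of I v] insert(4) by blast
    then show ?thesis using True by (intro exI[of _ c]) auto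
  next
    case False
    then obtain i0 where i0: "i0 \<in> I" "v i0 j0 \<noteq> 0" by blast
    \<comment> \<open>The unknown \<open>i0\<close> is eliminated with the pivot
      \<open>v i0 j0\<close>.\<close>
    define v' where "v' i j = v i j - v i j0 / v i0 j0 * v i0 j" for i j
    have "card J < card (I - {i0})" using insert i0 by simp
    then obtain c where c: "\<exists>i\<in>I - {i0}. c i \<noteq> 0"
      "\<forall>j\<in>J. (\<Sum>i\<in>I - {i0}. c i * v' i j) = 0"
      using insert(3)[of "I - {i0}" v'] insert(4) by blast
    \<comment> \<open>The value at \<open>i0\<close> is the one that solves the equation
      \<open>j0\<close>.\<close>
    define d where "d = c(i0 := - (\<Sum>i\<in>I - {i0}. c i * v i j0) / v i0 j0)"
    have dsum: "(\<Sum>i\<in>I. d i * v i j) = (\<Sum>i\<in>I - {i0}. c i * v' i j)" for j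
    proof -
      have "(\<Sum>i\<in>I. d i * v i j) = d i0 * v i0 j + (\<Sum>i\<in>I - {i0}. c i * v i j)"
        unfolding sum.remove[OF insert(4) i0(1)] by (simp add: d_def)
      also have "d i0 * v i0 j = - (\<Sum>i\<in>I - {i0}. c i * (v i j0 / v i0 j0 * v i0 j))"
        by (simp add: d_def sum_distrib_right sum_divide_distrib mult.assoc)
      also have "\<dots> + (\<Sum>i\<in>I - {i0}. c i * v i j) = (\<Sum>i\<in>I - {i0}. c i * v' i j)"
        by (simp add: v'_def right_diff_distrib sum_subtractf)
      finally show ?thesis .
    qed
    have "(\<Sum>i\<in>I. d i * v i j0) = 0" unfolding dsum using i0 by (simp add: v'_def)
    moreover have "\<exists>i\<in>I. d i \<noteq> 0" using c(1) by (auto simp: d_def)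
    ultimately show ?thesis using dsum c(2) by (intro exI[of _ d]) auto
  qed
qed

section \<open>Rational functions and their derivations over a subfield\<close>

abbreviation const_frac :: "'a::field \<Rightarrow> 'a mpoly fract" where
  "const_frac c \<equiv> to_frac (mconst c)"

lemma is_hom_to_frac: "is_hom to_frac"
  by (simp add: is_hom_def to_frac_def One_fract_def)

lemma to_frac_eq_iff: "to_frac p = to_frac q \<longleftrightarrow> p = q"
  by (simp add: to_frac_def eq_fract)

lemma to_frac_eq_0_iff: "to_frac p = 0 \<longleftrightarrow> p = 0"
  by (simp add: to_frac_def Zero_fract_def eq_fract)

lemma is_hom_const_frac: "is_hom const_frac"
  by (rule is_hom_comp[OF is_hom_to_frac is_hom_mconst])

lemma mconst_eq_iff: "mconst c = mconst d \<longleftrightarrow> c = d"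
  unfolding mconst_def by (metis lookup_single_eq)

lemma const_frac_eq_iff: "const_frac c = const_frac d \<longleftrightarrow> c = d"
  by (simp add: to_frac_eq_iff mconst_eq_iff)

lemma to_frac_msubst: "to_frac (msubst f g) = meval const_frac f (\<lambda>i. to_frac (g i))"
  unfolding msubst_def by (rule hom_meval[OF is_hom_to_frac is_hom_mconst])

text \<open>These derivations act on the rational functions with coefficients in the whole type
  \<open>'a\<close>. Constants outside \<open>F\<close> may be moved, and this is how
  \<open>K\<close> and \<open>L\<close> are told apart.\<close>

definition Der :: "'a::field set \<Rightarrow> ('a mpoly fract \<Rightarrow> 'a mpoly fract) \<Rightarrow> bool" where
  "Der F D \<longleftrightarrow> derivation D \<and> (\<forall>c\<in>F. D (const_frac c) = 0)"

lemma subfield_constants: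
  fixes D :: "'e::field \<Rightarrow> 'e"
  assumes D: "derivation D"
  shows "is_subfield {x. D x = 0}"
proof -
  have "D (inverse x) = 0" if "D x = 0" for x
  proof (cases "x = 0")
    case False
    have "D (x * inverse x) = 0" using False derivation_one[OF D] by simp
    then have "x * D (inverse x) = 0" using that derivation_mult[OF D, of x "inverse x"] by simp
    then show ?thesis using False by simp
  qed (simp add: derivation_zero[OF D])
  then show ?thesis unfolding is_subfield_def
    by (simp add: derivation_zero[OF D] derivation_one[OF D] derivation_add[OF D]
        derivation_mult[OF D] derivation_uminus[OF D])
qed

lemma Der_linear_combination:
  assumes "\<And>i. i \<in> I \<Longrightarrow> Der F (D i)"
  shows "Der F (\<lambda>x. \<Sum>i\<in>I. c i * D i x)"
  unfolding Der_def derivation_on_def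
proof (intro conjI ballI)
  have D: "derivation (D i)" if "i \<in> I" for i using assms that by (simp add: Der_def)
  fix x y
  show "(\<Sum>i\<in>I. c i * D i (x + y)) = (\<Sum>i\<in>I. c i * D i x) + (\<Sum>i\<in>I. c i * D i y)"
    by (simp add: sum.distrib[symmetric] distrib_left[symmetric] derivation_add[OF D])
  show "(\<Sum>i\<in>I. c i * D i (x * y)) = x * (\<Sum>i\<in>I. c i * D i y) + y * (\<Sum>i\<in>I. c i * D i x)"
    unfolding sum_distrib_left sum.distrib[symmetric]
    by (intro sum.cong refl) (simp add: derivation_mult[OF D] algebra_simps)
next
  fix b assume "b \<in> F"
  then show "(\<Sum>i\<in>I. c i * D i (const_frac b)) = 0"
    using assms by (simp add: Der_def)
qed

lemma Der_mono: "F \<subseteq> F' \<Longrightarrow> Der F' D \<Longrightarrow> Der F D"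
  by (auto simp: Der_def)

text \<open>The elements killed by \<open>D\<close> form a subfield, and it contains the
  generators.\<close>

lemma Der_gen_field:
  assumes "Der F D" "\<And>j. j < m \<Longrightarrow> D (to_frac (H j)) = 0" "x \<in> gen_field F H m"
  shows "D x = 0"
  using assms subfield_constants[of D] by (auto simp: gen_field_def Der_def)

text \<open>A family of \<open>F\<close>-derivations dual to \<open>S\<close>. In characteristic
  zero its existence is equivalent to algebraic independence over \<open>F\<close>, which turns
  questions on transcendence degree into linear algebra.\<close>

definition dual_indep :: "'a::field set \<Rightarrow> 'a mpoly fract set \<Rightarrow> bool" where
  "dual_indep F S \<longleftrightarrow> finite S \<and> (\<forall>z\<in>S. \<exists>D. Der F D \<and> D z = 1 \<and> (\<forall>w\<in>S - {z}. D w = 0))"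

text \<open>Independence makes the partial derivative with respect to \<open>z\<close> well defined
  on the ring F[S]; it then extends to the whole field.\<close>

lemma alg_indep_imp_dual_indep:
  fixes F :: "'a::field_char_0 set"
  assumes F: "is_subfield F" and S: "alg_indep F S"
  shows "dual_indep F S"
  unfolding dual_indep_def
proof (intro conjI ballI)
  show fin: "finite S" using S by (simp add: alg_indep_def)
  fix z assume z: "z \<in> S"
  define k where "k = card S"
  obtain e where e: "bij_betw e {..<k} S"
    using ex_bij_betw_nat_finite[OF fin] by (auto simp: k_def atLeast0LessThan)
  obtain i where i: "i < k" "e i = z" using e z by (auto simp: bij_betw_def)
  have inj: "e j = z \<longleftrightarrow> j = i" if "j < k" for j
    using e i that by (auto simp: bij_betw_def inj_on_def)
  \<comment> \<open>\<open>\<Phi> f\<close> is \<open>f\<close> evaluated at \<open>e\<close> with a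
    new variable added to the entry \<open>e i\<close>. Its value at 0 is f(e), and its derivative
    at 0 is the partial derivative with respect to \<open>z\<close>.\<close>
  define \<Phi> where "\<Phi> f = meval (\<lambda>c. [:const_frac c:]) f (\<lambda>j. if j = i then [:e i, 1:] else [:e j:])"
    for f :: "'a mpoly"
  have hc: "is_hom (\<lambda>c::'a. [:const_frac c:])"
    by (rule is_hom_comp[OF is_hom_pCons_zero is_hom_const_frac])
  have hom: "is_hom \<Phi>" unfolding \<Phi>_def by (rule is_hom_meval[OF hc])
  have ev: "poly (\<Phi> f) 0 = meval const_frac f e" for f
  proof -
    have "poly (if j = i then [:e i, 1:] else [:e j:]) 0 = e j" for j by simp
    then show ?thesis unfolding \<Phi>_def by (subst hom_meval[OF is_hom_poly hc]) simp
  qed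
  let ?R = "poly_ring F {..<k}"
  define G where "G = {(poly (\<Phi> f) 0, poly (pderiv (\<Phi> f)) 0) |f. f \<in> ?R}"
  have GI: "(poly (\<Phi> f) 0, poly (pderiv (\<Phi> f)) 0) \<in> G" if "f \<in> ?R" for f
    using that unfolding G_def by blast
  have mc: "(const_frac c, 0) \<in> G" if "c \<in> F" for c
    using GI[OF mconst_in_poly_ring[OF F that]] by (simp add: \<Phi>_def meval_mconst[OF hc])
  have "deriv_graph G"
    unfolding deriv_graph_def
  proof (intro conjI allI impI)
    show "(1, 0) \<in> G"
      using mc[OF subfield_closed(2)[OF F]] by (simp add: is_hom_one[OF is_hom_const_frac])
    show "b = 0" if b: "(0, b) \<in> G" for b
    proof -
      obtain f where f0: "f \<in> ?R" "(0, b) = (poly (\<Phi> f) 0, poly (pderiv (\<Phi> f)) 0)"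
        using b unfolding G_def by blast
      then have f: "f \<in> ?R" "poly (\<Phi> f) 0 = 0" "b = poly (pderiv (\<Phi> f)) 0" by simp_all
      then have "f = 0" using S e ev unfolding alg_indep_def k_def by simp
      then show ?thesis using f is_hom_zero[OF hom] by simp
    qed
    fix x x' y y' assume x: "(x, x') \<in> G" and y: "(y, y') \<in> G"
    obtain f where f: "f \<in> ?R" "x = poly (\<Phi> f) 0" "x' = poly (pderiv (\<Phi> f)) 0"
      using x unfolding G_def by blast
    obtain g where g: "g \<in> ?R" "y = poly (\<Phi> g) 0" "y' = poly (pderiv (\<Phi> g)) 0"
      using y unfolding G_def by blast
    show "(x + y, x' + y') \<in> G" using GI[OF poly_ring_add[OF F f(1) g(1)]] f g
      by (simp add: is_hom_add[OF hom] pderiv_add)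
    show "(x * y, x * y' + y * x') \<in> G" using GI[OF poly_ring_mult[OF F f(1) g(1)]] f g
      by (simp add: is_hom_mult[OF hom] pderiv_mult)
    show "(- x, - x') \<in> G" using GI[OF poly_ring_uminus[OF F f(1)]] f
      by (simp add: is_hom_uminus[OF hom] pderiv_minus)
  qed
  then obtain D where D: "derivation D" "\<And>x y. (x, y) \<in> G \<Longrightarrow> D x = y"
    using derivation_extension[of G UNIV] by (force simp: is_subfield_def)
  have var: "D (e j) = (if j = i then 1 else 0)" if "j < k" for j
    using D(2)[OF GI[OF mvar_in_poly_ring[OF F, of j]]] that
    by (auto simp: \<Phi>_def meval_mvar[OF hc] pderiv_pCons split: if_splits)
  have "D w = 0" if w: "w \<in> S - {z}" for w
  proof -
    obtain j where "j < k" "e j = w" using e w by (auto simp: bij_betw_def)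
    then show ?thesis using var[of j] w i by auto
  qed
  moreover have "Der F D" using D mc by (simp add: Der_def)
  ultimately show "\<exists>D. Der F D \<and> D z = 1 \<and> (\<forall>w\<in>S - {z}. D w = 0)" using var[of i] i by auto
qed

lemma eq_0_if_constant:
  assumes p: "vars_in V p" "\<And>\<alpha> i. \<alpha> \<in> Poly_Mapping.keys p \<Longrightarrow> i \<in> V \<Longrightarrow> Poly_Mapping.lookup \<alpha> i = 0"
    and 0: "meval const_frac p e = 0"
  shows "p = 0"
proof -
  have k0: "\<alpha> = 0" if \<alpha>: "\<alpha> \<in> Poly_Mapping.keys p" for \<alpha>
  proof (rule poly_mapping_eqI)
    fix i
    have "Poly_Mapping.keys \<alpha> \<subseteq> V" using p(1) \<alpha> by (simp add: vars_in_def)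
    then show "Poly_Mapping.lookup \<alpha> i = Poly_Mapping.lookup 0 i"
      using p(2)[OF \<alpha>, of i] by (cases "i \<in> V") (auto simp: in_keys_iff)
  qed
  then have "p = mconst (Poly_Mapping.lookup p 0)" unfolding mconst_def
    by (intro poly_mapping_eqI) (auto simp: lookup_single when_def in_keys_iff)
  then obtain c where c: "p = mconst c" by blast
  then have "const_frac c = 0" using 0 by (simp add: meval_mconst[OF is_hom_const_frac])
  then show ?thesis using c by (simp add: to_frac_eq_0_iff)
qed

text \<open>By the chain rule, a dual derivation applied to f(e) = 0 shows that a partial derivative
  of \<open>f\<close> vanishes at \<open>e\<close> too. Induction on a degree bound makes all
  partial derivatives 0, so in characteristic zero \<open>f\<close> is constant and hence 0.\<close>

lemma dual_indep_imp_alg_indep: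
  fixes F :: "'a::field_char_0 set"
  assumes F: "is_subfield F" and S: "dual_indep F S"
  shows "alg_indep F S"
  unfolding alg_indep_def
proof (intro conjI allI impI ballI)
  show "finite S" using S by (simp add: dual_indep_def)
  define k where "k = card S"
  fix e f assume "bij_betw e {..<card S} S" "f \<in> poly_ring F {..<card S}" "meval const_frac f e = 0"
  then have e: "bij_betw e {..<k} S" and f: "f \<in> poly_ring F {..<k}" "meval const_frac f e = 0"
    by (simp_all add: k_def)
  let ?deg = "\<lambda>\<alpha>. \<Sum>i<k. Poly_Mapping.lookup \<alpha> i"
  have pd: "meval const_frac (mpderiv i p) e = 0"
    if p: "p \<in> poly_ring F {..<k}" "meval const_frac p e = 0" and i: "i < k" for p i
  proof -
    have "e i \<in> S" using e i by (auto simp: bij_betw_def)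
    then obtain D where D: "Der F D" "D (e i) = 1" "\<forall>w\<in>S - {e i}. D w = 0"
      using S unfolding dual_indep_def by blast
    have De: "D (e j) = (if j = i then 1 else 0)" if "j < k" for j
      using D e i that by (auto simp: bij_betw_def inj_on_def)
    have Dd: "derivation D" using D(1) by (simp add: Der_def)
    have "D (meval const_frac p e) = (\<Sum>j<k. meval const_frac (mpderiv j p) e * D (e j))"
      using p(1) D(1) unfolding poly_ring_iff[OF F]
      by (intro chain_rule[OF is_hom_const_frac Dd]) (auto simp: Der_def)
    also have "\<dots> = (\<Sum>j<k. if j = i then meval const_frac (mpderiv j p) e else 0)"
      by (intro sum.cong refl) (simp add: De)
    also have "\<dots> = meval const_frac (mpderiv i p) e" using i by simp
    finally show ?thesis using p(2) derivation_zero[OF Dd] by simp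
  qed
  have "p = 0" if "p \<in> poly_ring F {..<k}" "meval const_frac p e = 0"
    "\<forall>\<alpha>\<in>Poly_Mapping.keys p. ?deg \<alpha> \<le> d" for d p
    using that
  proof (induct d arbitrary: p)
    case 0
    show ?case
    proof (rule eq_0_if_constant[OF poly_ringD(3)[OF 0(1)] _ 0(2)])
      fix \<alpha> i assume "\<alpha> \<in> Poly_Mapping.keys p" "i \<in> {..<k}"
      then show "Poly_Mapping.lookup \<alpha> i = 0" using 0(3) by simp
    qed
  next
    case (Suc d)
    have z: "mpderiv i p = 0" if i: "i < k" for i
    proof (rule Suc(1))
      show "mpderiv i p \<in> poly_ring F {..<k}" by (rule mpderiv_in_poly_ring[OF F Suc(2)])
      show "meval const_frac (mpderiv i p) e = 0" using pd Suc i by blast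
      show "\<forall>\<alpha>\<in>Poly_Mapping.keys (mpderiv i p). ?deg \<alpha> \<le> d"
      proof
        fix \<alpha> assume "\<alpha> \<in> Poly_Mapping.keys (mpderiv i p)"
        then have "\<alpha> + Poly_Mapping.single i 1 \<in> Poly_Mapping.keys p"
          by (auto simp: in_keys_iff lookup_mpderiv)
        then have "?deg (\<alpha> + Poly_Mapping.single i 1) \<le> Suc d" using Suc by blast
        moreover have "?deg (\<alpha> + Poly_Mapping.single i 1) = ?deg \<alpha> + 1"
          using i by (simp add: lookup_add sum.distrib lookup_single when_def)
        ultimately show "?deg \<alpha> \<le> d" by simp
      qed
    qed
    have "Poly_Mapping.lookup \<alpha> i = 0" if \<alpha>: "\<alpha> \<in> Poly_Mapping.keys p" and i: "i < k" for \<alpha> i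
    proof (rule ccontr)
      assume n: "Poly_Mapping.lookup \<alpha> i \<noteq> 0"
      define \<beta> where "\<beta> = \<alpha> - Poly_Mapping.single i 1"
      have "\<beta> + Poly_Mapping.single i 1 = \<alpha>" using n unfolding \<beta>_def
        by (intro poly_mapping_eqI) (auto simp: lookup_add lookup_minus lookup_single when_def)
      then have "of_nat (Suc (Poly_Mapping.lookup \<beta> i)) * Poly_Mapping.lookup p \<alpha> = 0"
        using lookup_mpderiv[of i p \<beta>] z[OF i] by simp
      then show False using \<alpha> by (simp add: in_keys_iff del: of_nat_Suc)
    qed
    then show ?case
      using eq_0_if_constant[OF poly_ringD(3)[OF Suc(2)] _ Suc(3)] by simp
  qed
  \<comment> \<open>The sum of the degrees of all monomials is a crude degree bound.\<close>
  from this[OF f, of "\<Sum>\<alpha>\<in>Poly_Mapping.keys f. ?deg \<alpha>"]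
  show "f = 0" using member_le_sum[of _ "Poly_Mapping.keys f" ?deg] by auto
qed

lemma gen_field_gens: "i < m \<Longrightarrow> to_frac (H i) \<in> gen_field F H m"
  by (auto simp: gen_field_def)

text \<open>\<open>T\<close> is a largest dually independent set of components of \<open>H\<close>.
  A derivation that kills \<open>T\<close> but not some \<open>H j\<close> would allow this
  component to be added to \<open>T\<close>.\<close>

lemma trdeg_basis:
  fixes F :: "'a::field_char_0 set"
  assumes F: "is_subfield F"
  shows "\<exists>T \<subseteq> (\<lambda>i. to_frac (H i)) ` {..<m}. dual_indep F T \<and> card T = trdeg_gen F H m
     \<and> (\<forall>D. Der F D \<longrightarrow> (\<forall>t\<in>T. D t = 0) \<longrightarrow> (\<forall>j<m. D (to_frac (H j)) = 0))"
proof -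
  let ?h = "(\<lambda>i. to_frac (H i)) ` {..<m}"
  let ?P = "\<lambda>T. T \<subseteq> ?h \<and> dual_indep F T"
  have "?P {}" by (simp add: dual_indep_def)
  moreover have "\<forall>T. ?P T \<longrightarrow> card T < Suc (card ?h)" by (auto simp: less_Suc_eq_le intro!: card_mono)
  ultimately obtain T where T: "?P T" and max: "\<And>T'. ?P T' \<Longrightarrow> card T' \<le> card T"
    using ex_has_greatest_nat[of ?P "{}" card "Suc (card ?h)"] by (metis less_imp_le)
  have finT: "finite T" using T by (simp add: dual_indep_def)
  have span: "D (to_frac (H j)) = 0" if D: "Der F D" "\<forall>t\<in>T. D t = 0" "j < m" for D j
  proof (rule ccontr)
    let ?x = "to_frac (H j)"
    assume x: "D ?x \<noteq> 0"
    then have xT: "?x \<notin> T" using D by auto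
    have "dual_indep F (insert ?x T)"
      unfolding dual_indep_def
    proof (intro conjI ballI)
      show "finite (insert ?x T)" using finT by simp
      fix z assume z: "z \<in> insert ?x T"
      show "\<exists>D. Der F D \<and> D z = 1 \<and> (\<forall>w\<in>insert ?x T - {z}. D w = 0)"
      proof (cases "z = ?x")
        case True
        have "Der F (\<lambda>y. \<Sum>i\<in>{()}. inverse (D ?x) * D y)"
          by (rule Der_linear_combination) (rule D(1))
        then show ?thesis using True x D(2) by (intro exI[of _ "\<lambda>y. inverse (D ?x) * D y"]) auto
      next
        case False
        then have zT: "z \<in> T" using z by simp
        then obtain D' where D': "Der F D'" "D' z = 1" "\<forall>w\<in>T - {z}. D' w = 0"
          using T unfolding dual_indep_def by blast
        \<comment> \<open>A multiple of \<open>D\<close> is subtracted to kill \<open>?x\<close>; as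
          \<open>D\<close> vanishes on \<open>T\<close>, the values of \<open>D'\<close> on
          \<open>T\<close> do not change. The two terms are indexed by \<open>bool\<close>.\<close>
        have "Der F (\<lambda>y. \<Sum>b\<in>UNIV. (if b then 1 else - D' ?x / D ?x) * (if b then D' else D) y)"
          by (rule Der_linear_combination) (use D(1) D'(1) in auto)
        then have "Der F (\<lambda>y. D' y - D' ?x / D ?x * D y)" by (simp add: UNIV_bool)
        then show ?thesis using x D(2) D' zT by (intro exI[of _ "\<lambda>y. D' y - D' ?x / D ?x * D y"]) auto
      qed
    qed
    then have "card (insert ?x T) \<le> card T" using max[of "insert ?x T"] T D(3) by auto
    then show False using finT xT by simp
  qed
  let ?A = "{S. S \<subseteq> gen_field F H m \<and> alg_indep F S}"
  have TA: "T \<in> ?A" using T gen_field_gens dual_indep_imp_alg_indep[OF F] by blast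
  \<comment> \<open>With more elements in \<open>S\<close> than in \<open>T\<close>, a nontrivial
    combination of the derivations dual to \<open>S\<close> kills \<open>T\<close>, hence all
    components of \<open>H\<close> and the whole generated field. Yet its value at each
    \<open>z\<close> in \<open>S\<close> is \<open>c z\<close>.\<close>
  have bound: "card S \<le> card T" if S: "S \<in> ?A" for S
  proof (rule ccontr)
    assume less: "\<not> card S \<le> card T"
    have di: "dual_indep F S" using alg_indep_imp_dual_indep[OF F] S by blast
    then have finS: "finite S" by (simp add: dual_indep_def)
    obtain D where D: "\<And>z. z \<in> S \<Longrightarrow> Der F (D z) \<and> D z z = 1 \<and> (\<forall>w\<in>S - {z}. D z w = 0)"
      using di unfolding dual_indep_def by metis
    obtain c where c: "\<exists>z\<in>S. c z \<noteq> 0" "\<forall>t\<in>T. (\<Sum>z\<in>S. c z * D z t) = 0"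
      using homogeneous_system_solvable[OF finT finS, of D] less by auto
    define D0 where "D0 x = (\<Sum>z\<in>S. c z * D z x)" for x
    have D0: "Der F D0" unfolding D0_def by (rule Der_linear_combination) (use D in blast)
    have k: "D0 x = 0" if "x \<in> gen_field F H m" for x
      using Der_gen_field[OF D0 _ that] span[OF D0] c(2) by (simp add: D0_def)
    obtain z where z: "z \<in> S" "c z \<noteq> 0" using c(1) by blast
    have "D0 z = (\<Sum>y\<in>S. if y = z then c z else 0)" unfolding D0_def
      by (intro sum.cong refl) (use D z in auto)
    then have "D0 z = c z" using finS z by simp
    then show False using k z S by auto
  qed
  \<comment> \<open>The cardinalities are bounded by \<open>card T\<close> and attain it, so the
    supremum of naturals has its intended value.\<close>
  have "trdeg_gen F H m = card T"
    unfolding trdeg_gen_def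
    by (rule cSup_eq_maximum) (use TA bound in auto)
  then show ?thesis using T span by (intro exI[of _ T]) auto
qed

text \<open>Let \<open>T\<close> and \<open>U\<close> be bases of components of \<open>H\<close>
  over \<open>K\<close> and over \<open>L\<close>. Together with \<open>D\<close>, the
  \<open>L\<close>-derivations dual to \<open>U\<close> outnumber \<open>T\<close>, so a nontrivial
  combination kills \<open>T\<close> and with it every component of \<open>H\<close>. The
  coefficient of \<open>D\<close> cannot be 0, and dividing by it gives the correction of
  \<open>D\<close>.\<close>

lemma derivation_killing_generators:
  fixes K L :: "'a::field_char_0 set"
  assumes K: "is_subfield K" and L: "is_subfield L" and KL: "K \<subseteq> L"
    and tr: "trdeg_gen K H m \<le> trdeg_gen L H m"
    and D: "Der K D"
  shows "\<exists>D'. Der K D' \<and> (\<forall>j<m. D' (to_frac (H j)) = 0) \<and> (\<forall>l\<in>L. D' (const_frac l) = D (const_frac l))"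
proof -
  obtain T where T: "dual_indep K T" "card T = trdeg_gen K H m"
    "\<And>D j. Der K D \<Longrightarrow> \<forall>t\<in>T. D t = 0 \<Longrightarrow> j < m \<Longrightarrow> D (to_frac (H j)) = 0"
    using trdeg_basis[OF K, of H m] by blast
  obtain U where U: "U \<subseteq> (\<lambda>i. to_frac (H i)) ` {..<m}" "dual_indep L U" "card U = trdeg_gen L H m"
    using trdeg_basis[OF L, of H m] by blast
  have fin: "finite T" "finite U" using T U by (auto simp: dual_indep_def)
  obtain E where E: "\<And>z. z \<in> U \<Longrightarrow> Der L (E z) \<and> E z z = 1 \<and> (\<forall>w\<in>U - {z}. E z w = 0)"
    using U(2) unfolding dual_indep_def by metis
  \<comment> \<open>\<open>None\<close> stands for \<open>D\<close> itself and \<open>Some z\<close>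
    for the derivation dual to \<open>z\<close>, which gives one index more than elements of
    \<open>U\<close>.\<close>
  define I where "I = insert None (Some ` U)"
  define B where "B i = (case i of None \<Rightarrow> D | Some z \<Rightarrow> E z)" for i
  have BK: "Der K (B i)" if "i \<in> I" for i
    using that D E Der_mono[OF KL] by (auto simp: I_def B_def)
  have "card T < card I"
    using fin tr T(2) U(3) by (simp add: I_def card_image)
  then obtain c where c: "\<exists>i\<in>I. c i \<noteq> 0" "\<forall>t\<in>T. (\<Sum>i\<in>I. c i * B i t) = 0"
    using homogeneous_system_solvable[OF fin(1), of I B] fin by (auto simp: I_def)
  define D0 where "D0 x = (\<Sum>i\<in>I. c i * B i x)" for x
  have D0: "Der K D0" unfolding D0_def by (rule Der_linear_combination) (rule BK)
  have D0H: "D0 (to_frac (H j)) = 0" if "j < m" for j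
    using T(3)[OF D0 _ that] c(2) by (simp add: D0_def)
  have D0_eq: "D0 x = c None * D x + (\<Sum>z\<in>U. c (Some z) * E z x)" for x
    using fin by (simp add: D0_def I_def B_def sum.reindex)
  \<comment> \<open>Otherwise some \<open>c (Some z)\<close> is nonzero, and it is the value of
    \<open>D0\<close> at \<open>z\<close>. But \<open>z\<close> is a component of \<open>H\<close>,
    which \<open>D0\<close> kills.\<close>
  have c0: "c None \<noteq> 0"
  proof
    assume n: "c None = 0"
    then obtain z where z: "z \<in> U" "c (Some z) \<noteq> 0" using c(1) by (auto simp: I_def)
    have "D0 z = (\<Sum>y\<in>U. if y = z then c (Some z) else 0)" unfolding D0_eq using n E z
      by (auto intro!: sum.cong)
    then have "D0 z = c (Some z)" using fin z by simp
    then show False using z U(1) D0H by auto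
  qed
  have D': "Der K (\<lambda>y. \<Sum>i\<in>{()}. inverse (c None) * D0 y)"
    by (rule Der_linear_combination) (rule D0)
  \<comment> \<open>The \<open>L\<close>-derivations vanish on \<open>L\<close>, so only
    \<open>D\<close> is left there.\<close>
  have "inverse (c None) * D0 (const_frac l) = D (const_frac l)" if "l \<in> L" for l
    using that E c0 unfolding D0_eq by (simp add: Der_def)
  then show ?thesis using D' D0H by (intro exI[of _ "\<lambda>y. inverse (c None) * D0 y"]) simp
qed

section \<open>Linear disjointness\<close>

lemma const_frac_eq_0_iff: "const_frac c = 0 \<longleftrightarrow> c = 0"
  using const_frac_eq_iff[of c 0] is_hom_zero[OF is_hom_const_frac] by metis

text \<open>As \<open>K\<close> is algebraically closed in \<open>L\<close>, the element
  \<open>l\<close> is transcendental over \<open>K\<close>. The formal derivative on K[l] is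
  therefore well defined, and it extends to \<open>L\<close>.\<close>

lemma derivation_moving:
  fixes K L :: "'a::field_char_0 set"
  assumes K: "is_subfield K" and L: "is_subfield L" and KL: "K \<subseteq> L"
    and ac: "alg_closed_in K L" and l: "l \<in> L" "l \<notin> K"
  shows "\<exists>D. derivation_on L D \<and> D ` L \<subseteq> L \<and> (\<forall>c\<in>K. D c = 0) \<and> D l \<noteq> 0"
proof -
  define G where "G = {(poly p l, poly (pderiv p) l) |p. \<forall>i. coeff p i \<in> K}"
  have GI: "(poly p l, poly (pderiv p) l) \<in> G" if "\<And>i. coeff p i \<in> K" for p
    using that unfolding G_def by blast
  have "deriv_graph G"
    unfolding deriv_graph_def
  proof (intro conjI allI impI)
    show "(1, 0) \<in> G" using GI[of 1] subfield_closed(1,2)[OF K] by (simp add: coeff_1)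
    show "b = 0" if b: "(0, b) \<in> G" for b
    proof -
      obtain p where p: "\<forall>i. coeff p i \<in> K" "(0, b) = (poly p l, poly (pderiv p) l)"
        using b unfolding G_def by blast
      then have "p = 0" using ac l unfolding alg_closed_in_def by auto
      then show ?thesis using p by simp
    qed
    fix x x' y y' assume x: "(x, x') \<in> G" and y: "(y, y') \<in> G"
    obtain p where p: "\<And>i. coeff p i \<in> K" "x = poly p l" "x' = poly (pderiv p) l"
      using x unfolding G_def by blast
    obtain q where q: "\<And>i. coeff q i \<in> K" "y = poly q l" "y' = poly (pderiv q) l"
      using y unfolding G_def by blast
    show "(x + y, x' + y') \<in> G" using GI[of "p + q"] p q
      by (simp add: subfield_closed[OF K] pderiv_add)
    have "coeff (p * q) i \<in> K" for i
      unfolding coeff_mult by (intro subfield_sum[OF K] subfield_closed(4)[OF K] p q)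
    from GI[OF this] show "(x * y, x * y' + y * x') \<in> G" using p q by (simp add: pderiv_mult)
    show "(- x, - x') \<in> G" using GI[of "- p"] p by (simp add: subfield_closed[OF K] pderiv_minus)
  qed
  moreover have "G \<subseteq> L \<times> L"
  proof
    fix z assume "z \<in> G"
    then obtain p where p: "\<And>i. coeff p i \<in> K" "z = (poly p l, poly (pderiv p) l)"
      unfolding G_def by blast
    then have "coeff p i \<in> L" for i using KL by blast
    then show "z \<in> L \<times> L" using p(2) l(1)
      by (auto intro!: subfield_poly[OF L] subfield_coeff_pderiv[OF L])
  qed
  ultimately obtain D where D: "derivation_on L D" "D ` L \<subseteq> L" "\<forall>(x, y)\<in>G. D x = y"
    using derivation_extension[OF _ L] by blast
  have D': "D (poly p l) = poly (pderiv p) l" if "\<And>i. coeff p i \<in> K" for p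
    using D(3) GI[OF that] by fastforce
  have "D c = 0" if "c \<in> K" for c
    using D'[of "[:c:]"] that subfield_closed(1)[OF K] by (auto simp: coeff_pCons split: nat.splits)
  moreover have "D l = 1"
    using D'[of "[:0, 1:]"] subfield_closed(1,2)[OF K]
    by (auto simp: coeff_pCons pderiv_pCons split: nat.splits)
  ultimately show ?thesis using D by (intro exI[of _ D]) simp
qed

text \<open>The derivation is carried over to the copy of \<open>L\<close> among the constant
  rational functions and extended from there.\<close>

lemma derivation_extend_const:
  fixes K L :: "'a::field_char_0 set"
  assumes L: "is_subfield L" and KL: "K \<subseteq> L"
    and D: "derivation_on L D" "\<forall>c\<in>K. D c = 0"
  shows "\<exists>D'. Der K D' \<and> (\<forall>l\<in>L. D' (const_frac l) = const_frac (D l))"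
proof -
  note hom = is_hom_const_frac
  define G where "G = {(const_frac x, const_frac (D x)) |x. x \<in> L}"
  have GI: "(const_frac x, const_frac (D x)) \<in> G" if "x \<in> L" for x
    using that unfolding G_def by blast
  have Da: "D (x + y) = D x + D y" and Dm: "D (x * y) = x * D y + y * D x"
    if "x \<in> L" "y \<in> L" for x y using D(1) that by (auto simp: derivation_on_def)
  note Lc = subfield_closed[OF L]
  have D0: "D 0 = 0" using Da[of 0 0] Lc(1) by simp
  have D1: "D 1 = 0" using Dm[of 1 1] Lc(2) by simp
  have Du: "D (- x) = - D x" if "x \<in> L" for x
    using Da[of "- x" x] that Lc D0 by (simp add: eq_neg_iff_add_eq_0)
  have "deriv_graph G"
    unfolding deriv_graph_def
  proof (intro conjI allI impI)
    show "(1, 0) \<in> G" using GI[of 1] Lc(2) D1 by (simp add: is_hom_one[OF hom] is_hom_zero[OF hom])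
    show "b = 0" if b: "(0, b) \<in> G" for b
    proof -
      obtain x where x: "x \<in> L" "(0, b) = (const_frac x, const_frac (D x))"
        using b unfolding G_def by blast
      then have "x = 0" by (simp add: const_frac_eq_0_iff)
      then show ?thesis using x D0 is_hom_zero[OF hom] by simp
    qed
    fix x x' y y' assume x: "(x, x') \<in> G" and y: "(y, y') \<in> G"
    obtain p where p: "p \<in> L" "x = const_frac p" "x' = const_frac (D p)"
      using x unfolding G_def by blast
    obtain q where q: "q \<in> L" "y = const_frac q" "y' = const_frac (D q)"
      using y unfolding G_def by blast
    show "(x + y, x' + y') \<in> G" using GI[OF Lc(3)[OF p(1) q(1)]] p q Da
      by (simp add: is_hom_add[OF hom])
    show "(x * y, x * y' + y * x') \<in> G" using GI[OF Lc(4)[OF p(1) q(1)]] p q Dm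
      by (simp add: is_hom_add[OF hom] is_hom_mult[OF hom])
    show "(- x, - x') \<in> G" using GI[OF Lc(5)[OF p(1)]] p Du by (simp add: is_hom_uminus[OF hom])
  qed
  then obtain D' where D': "derivation D'" "\<And>x y. (x, y) \<in> G \<Longrightarrow> D' x = y"
    using derivation_extension[of G UNIV] by (force simp: is_subfield_def)
  have "Der K D'" unfolding Der_def using D' GI KL D(2) is_hom_zero[OF hom] by fastforce
  then show ?thesis using D' GI by blast
qed

section \<open>Linear independence over a subfield\<close>

definition indep_over :: "'a::field set \<Rightarrow> ('i \<Rightarrow> 'a) \<Rightarrow> 'i set \<Rightarrow> bool" where
  "indep_over F v J \<longleftrightarrow> (\<forall>c. (\<forall>j\<in>J. c j \<in> F) \<and> (\<Sum>j\<in>J. c j * v j) = 0 \<longrightarrow> (\<forall>j\<in>J. c j = 0))"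

lemma indep_overD:
  "indep_over F v J \<Longrightarrow> (\<And>j. j \<in> J \<Longrightarrow> c j \<in> F) \<Longrightarrow> (\<Sum>j\<in>J. c j * v j) = 0 \<Longrightarrow> j \<in> J \<Longrightarrow> c j = 0"
  by (simp add: indep_over_def)

text \<open>A maximal independent subfamily containing \<open>J0\<close> spans all the others.
  Prescribing \<open>J0\<close> makes it possible to keep the element 1 in the basis used for the
  final decomposition.\<close>

lemma basis_extension:
  assumes F: "is_subfield F" and I: "finite I" and "J0 \<subseteq> I" "indep_over F v J0"
  shows "\<exists>J c. J0 \<subseteq> J \<and> J \<subseteq> I \<and> indep_over F v J
    \<and> (\<forall>i\<in>I. (\<forall>j\<in>J. c i j \<in> F) \<and> v i = (\<Sum>j\<in>J. c i j * v j))"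
proof -
  let ?P = "\<lambda>J. J0 \<subseteq> J \<and> J \<subseteq> I \<and> indep_over F v J"
  have "\<forall>J. ?P J \<longrightarrow> card J < Suc (card I)" using I by (auto simp: less_Suc_eq_le intro!: card_mono)
  moreover have "?P J0" using assms by blast
  ultimately obtain J where J: "?P J" and max: "\<And>J'. ?P J' \<Longrightarrow> card J' \<le> card J"
    using ex_has_greatest_nat[of ?P J0 card "Suc (card I)"] by (metis less_imp_le)
  have finJ: "finite J" using J I finite_subset by blast
  have "\<exists>c. (\<forall>j\<in>J. c j \<in> F) \<and> v i = (\<Sum>j\<in>J. c j * v j)" if i: "i \<in> I" for i
  proof (cases "i \<in> J")
    case True
    have "v i = (\<Sum>j\<in>J. if j = i then v i else 0)" using finJ True by simp
    also have "\<dots> = (\<Sum>j\<in>J. (if j = i then 1 else 0) * v j)" by (intro sum.cong) auto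
    finally show ?thesis using subfield_closed(1,2)[OF F]
      by (intro exI[of _ "\<lambda>j. if j = i then 1 else 0"]) auto
  next
    case False
    have "\<not> indep_over F v (insert i J)"
    proof
      assume "indep_over F v (insert i J)"
      then have "card (insert i J) \<le> card J" using max[of "insert i J"] J i by blast
      then show False using finJ False by simp
    qed
    then obtain c where c: "\<forall>j\<in>insert i J. c j \<in> F" "(\<Sum>j\<in>insert i J. c j * v j) = 0"
      "\<exists>j\<in>insert i J. c j \<noteq> 0" unfolding indep_over_def by blast
    have eq: "c i * v i + (\<Sum>j\<in>J. c j * v j) = 0" using c(2) finJ False by simp
    have ci: "c i \<noteq> 0"
    proof
      assume "c i = 0"
      then have "(\<forall>j\<in>J. c j \<in> F) \<and> (\<Sum>j\<in>J. c j * v j) = 0" using c(1) eq by simp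
      then have "\<forall>j\<in>J. c j = 0" using J unfolding indep_over_def by blast
      then show False using c(3) \<open>c i = 0\<close> by blast
    qed
    have "c i * v i = - (\<Sum>j\<in>J. c j * v j)" using eq by (simp add: eq_neg_iff_add_eq_0)
    then have "v i = - (\<Sum>j\<in>J. c j * v j) / c i" using ci by (metis nonzero_mult_div_cancel_left)
    also have "\<dots> = (\<Sum>j\<in>J. (- c j / c i) * v j)"
      by (simp add: sum_divide_distrib sum_negf)
    finally show ?thesis using c(1)
      by (intro exI[of _ "\<lambda>j. - c j / c i"]) (auto intro!: subfield_closed[OF F])
  qed
  then obtain c where "\<forall>i\<in>I. (\<forall>j\<in>J. c i j \<in> F) \<and> v i = (\<Sum>j\<in>J. c i j * v j)" by metis
  then show ?thesis using J by blast
qed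

lemma lookup_mconst_mult: "Poly_Mapping.lookup (mconst c * p) \<alpha> = c * Poly_Mapping.lookup p \<alpha>"
  unfolding mconst_def mult_map_scale_conv_mult[symmetric]
  by (simp add: Poly_Mapping.map.rep_eq when_def)

text \<open>The \<open>\<mu> i\<close> are expanded in a basis of their span over \<open>L\<close>.
  As the coefficients of the \<open>\<gamma> i\<close> lie in \<open>L\<close>, the relation splits
  into one relation over \<open>L\<close> for each basis element.\<close>

lemma dependence_descends:
  fixes L :: "'a::field set"
  assumes L: "is_subfield L" and I: "finite I"
    and \<gamma>: "\<And>i \<alpha>. i \<in> I \<Longrightarrow> Poly_Mapping.lookup (\<gamma> i) \<alpha> \<in> L"
    and \<mu>: "\<exists>i\<in>I. \<mu> i \<noteq> 0" "(\<Sum>i\<in>I. mconst (\<mu> i) * \<gamma> i) = 0"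
  shows "\<exists>l. (\<forall>i\<in>I. l i \<in> L) \<and> (\<exists>i\<in>I. l i \<noteq> 0) \<and> (\<Sum>i\<in>I. mconst (l i) * \<gamma> i) = 0"
proof -
  obtain J c where J: "J \<subseteq> I" "indep_over L \<mu> J"
    and c: "\<forall>i\<in>I. (\<forall>j\<in>J. c i j \<in> L) \<and> \<mu> i = (\<Sum>j\<in>J. c i j * \<mu> j)"
    using basis_extension[OF L I, of "{}" \<mu>] by (auto simp: indep_over_def)
  obtain i0 where i0: "i0 \<in> I" "\<mu> i0 \<noteq> 0" using \<mu>(1) by blast
  \<comment> \<open>A basis element that occurs in the nonzero \<open>\<mu> i0\<close> makes its
    relation nontrivial.\<close>
  have "\<exists>j\<in>J. c i0 j \<noteq> 0"
  proof (rule ccontr)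
    assume "\<not> ?thesis"
    then have "(\<Sum>j\<in>J. c i0 j * \<mu> j) = 0" by (intro sum.neutral) auto
    then show False using c i0 by auto
  qed
  then obtain j0 where j0: "j0 \<in> J" "c i0 j0 \<noteq> 0" by blast
  have "(\<Sum>i\<in>I. c i j0 * Poly_Mapping.lookup (\<gamma> i) \<alpha>) = 0" for \<alpha>
  proof -
    let ?g = "\<lambda>i. Poly_Mapping.lookup (\<gamma> i) \<alpha>"
    have "(\<Sum>j\<in>J. (\<Sum>i\<in>I. c i j * ?g i) * \<mu> j) = (\<Sum>i\<in>I. (\<Sum>j\<in>J. c i j * \<mu> j) * ?g i)"
      unfolding sum_distrib_right by (subst sum.swap) (simp add: ac_simps)
    also have "\<dots> = (\<Sum>i\<in>I. \<mu> i * ?g i)" using c by (intro sum.cong) auto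
    also have "\<dots> = Poly_Mapping.lookup (\<Sum>i\<in>I. mconst (\<mu> i) * \<gamma> i) \<alpha>"
      by (simp add: lookup_sum lookup_mconst_mult)
    finally have "(\<Sum>j\<in>J. (\<Sum>i\<in>I. c i j * ?g i) * \<mu> j) = 0" using \<mu>(2) by simp
    moreover have "(\<Sum>i\<in>I. c i j * ?g i) \<in> L" if "j \<in> J" for j
      using c \<gamma> that by (auto intro!: subfield_sum[OF L] subfield_closed(4)[OF L])
    ultimately show ?thesis
      using indep_overD[OF J(2), of "\<lambda>j. \<Sum>i\<in>I. c i j * ?g i", OF _ _ j0(1)] by blast
  qed
  then have "(\<Sum>i\<in>I. mconst (c i j0) * \<gamma> i) = 0"
    by (intro poly_mapping_eqI) (simp add: lookup_sum lookup_mconst_mult)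
  then show ?thesis using c i0 j0 by (intro exI[of _ "\<lambda>i. c i j0"]) auto
qed

text \<open>A relation over \<open>L\<close> with minimal support and one coefficient equal to 1 has its coefficients
  in \<open>K\<close>, since derivations of \<open>L\<close> that extend by zero on \<open>\<gamma>\<close> shorten it.\<close>
lemma relation_over_constants:
  fixes K L :: "'a::field_char_0 set"
  assumes K: "is_subfield K" and L: "is_subfield L"
    and mov: "\<And>l. l \<in> L - K \<Longrightarrow> \<exists>D0 D. derivation_on L D0 \<and> D0 ` L \<subseteq> L \<and> D0 l \<noteq> 0 \<and> derivation D
        \<and> (\<forall>x\<in>L. D (const_frac x) = const_frac (D0 x)) \<and> (\<forall>i\<in>I. D (\<gamma> i) = 0)"
    and I: "finite I" and l: "\<forall>i\<in>I. l i \<in> L" "\<exists>i\<in>I. l i \<noteq> 0"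
    and rel: "(\<Sum>i\<in>I. const_frac (l i) * \<gamma> i) = 0"
  shows "\<exists>k. (\<forall>i\<in>I. k i \<in> K) \<and> (\<exists>i\<in>I. k i \<noteq> 0) \<and> (\<Sum>i\<in>I. const_frac (k i) * \<gamma> i) = 0"
  using l rel
proof (induct "card {i \<in> I. l i \<noteq> 0}" arbitrary: l rule: less_induct)
  case less
  note hom = is_hom_const_frac
  obtain i0 where i0: "i0 \<in> I" "l i0 \<noteq> 0" using less(3) by blast
  \<comment> \<open>With the coefficient at \<open>i0\<close> normalised to 1, every derivation
    kills it.\<close>
  define l' where "l' i = l i / l i0" for i
  have l'L: "l' i \<in> L" if "i \<in> I" for i
    using less(2) i0 that unfolding l'_def by (intro subfield_closed[OF L]) auto
  have "(\<Sum>i\<in>I. const_frac (l' i) * \<gamma> i) = const_frac (inverse (l i0)) * (\<Sum>i\<in>I. const_frac (l i) * \<gamma> i)"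
    unfolding sum_distrib_left
    by (intro sum.cong refl) (simp add: l'_def divide_inverse is_hom_mult[OF hom] ac_simps)
  then have rel': "(\<Sum>i\<in>I. const_frac (l' i) * \<gamma> i) = 0" using less(4) by simp
  show ?case
  proof (cases "\<forall>i\<in>I. l' i \<in> K")
    case True
    then show ?thesis using rel' i0 by (intro exI[of _ l']) (auto simp: l'_def)
  next
    case False
    then obtain i1 where i1: "i1 \<in> I" "l' i1 \<in> L - K" using l'L by blast
    obtain D0 D where D0: "derivation_on L D0" "D0 ` L \<subseteq> L" "D0 (l' i1) \<noteq> 0" and D: "derivation D"
      "\<forall>x\<in>L. D (const_frac x) = const_frac (D0 x)" "\<forall>i\<in>I. D (\<gamma> i) = 0"
      using mov[OF i1(2)] by blast
    have z: "D0 0 = 0" "D0 1 = 0"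
      using D0(1) subfield_closed(1,2)[OF L] unfolding derivation_on_def
      by (metis add_cancel_right_right, metis add_cancel_right_right mult_1)
    have "(\<Sum>i\<in>I. const_frac (D0 (l' i)) * \<gamma> i) = D (\<Sum>i\<in>I. const_frac (l' i) * \<gamma> i)"
      using D(2,3) l'L by (simp add: derivation_sum[OF D(1)] derivation_mult[OF D(1)] mult.commute)
    then have "(\<Sum>i\<in>I. const_frac (D0 (l' i)) * \<gamma> i) = 0" using rel' derivation_zero[OF D(1)] by simp
    \<comment> \<open>The index \<open>i0\<close> leaves the support and no index enters it. The new
      relation is nontrivial because \<open>l' i1\<close> is moved.\<close>
    moreover have "card {i \<in> I. D0 (l' i) \<noteq> 0} < card {i \<in> I. l i \<noteq> 0}"
    proof (rule psubset_card_mono)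
      have "i0 \<notin> {i \<in> I. D0 (l' i) \<noteq> 0}" using i0 z by (simp add: l'_def)
      moreover have "{i \<in> I. D0 (l' i) \<noteq> 0} \<subseteq> {i \<in> I. l i \<noteq> 0}" using z by (auto simp: l'_def)
      ultimately show "{i \<in> I. D0 (l' i) \<noteq> 0} \<subset> {i \<in> I. l i \<noteq> 0}" using i0 by blast
    qed (use I in simp)
    moreover have "\<forall>i\<in>I. D0 (l' i) \<in> L" using D0(2) l'L by blast
    moreover have "\<exists>i\<in>I. D0 (l' i) \<noteq> 0" using i1 D0(3) by blast
    ultimately show ?thesis using less(1)[of "\<lambda>i. D0 (l' i)"] by blast
  qed
qed

text \<open>The \<open>\<mu> i\<close> are arbitrary elements of the big field. The dependence first
  descends to \<open>L\<close>, because the values of the \<open>g i\<close> at \<open>H\<close>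
  have coefficients in \<open>L\<close>, and then to \<open>K\<close> by means of
  derivations.\<close>

lemma linear_disjointness:
  fixes K L :: "'a::field_char_0 set"
  assumes K: "is_subfield K" and L: "is_subfield L" and KL: "K \<subseteq> L"
    and ac: "alg_closed_in K L" and HL: "\<forall>i<m. H i \<in> poly_ring L {..<n}"
    and tr: "trdeg_gen K H m \<le> trdeg_gen L H m"
    and I: "finite I" and g: "\<forall>i\<in>I. g i \<in> poly_ring K {..<m}"
    and \<mu>: "\<exists>i\<in>I. \<mu> i \<noteq> 0" "(\<Sum>i\<in>I. mconst (\<mu> i) * msubst (g i) H) = 0"
  shows "\<exists>k. (\<forall>i\<in>I. k i \<in> K) \<and> (\<exists>i\<in>I. k i \<noteq> 0) \<and> (\<Sum>i\<in>I. mconst (k i) * msubst (g i) H) = 0"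
proof -
  note hom = is_hom_const_frac
  have sub: "msubst p H \<in> poly_ring L {..<n}" if p: "p \<in> poly_ring K {..<m}" for p
  proof -
    have one: "1 \<in> poly_ring L {..<n}"
      using mconst_in_poly_ring[OF L subfield_closed(2)[OF L]] is_hom_one[OF is_hom_mconst] by metis
    have pow: "q ^ k \<in> poly_ring L {..<n}" if "q \<in> poly_ring L {..<n}" for q k
      by (induct k) (simp_all add: one poly_ring_mult[OF L] that)
    have prd: "(\<And>i. i \<in> A \<Longrightarrow> f i \<in> poly_ring L {..<n}) \<Longrightarrow> prod f A \<in> poly_ring L {..<n}" for f and A :: "nat set"
      by (induct A rule: infinite_finite_induct) (simp_all add: one poly_ring_mult[OF L])
    show ?thesis unfolding msubst_def meval_def
    proof (intro poly_ring_sum[OF L] poly_ring_mult[OF L] mconst_in_poly_ring[OF L] prd pow)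
      fix \<alpha> i assume \<alpha>: "\<alpha> \<in> Poly_Mapping.keys p"
      show "Poly_Mapping.lookup p \<alpha> \<in> L" using poly_ringD(1)[OF p \<alpha>] KL by blast
      show "H i \<in> poly_ring L {..<n}" if "i \<in> Poly_Mapping.keys \<alpha>"
        using poly_ringD(2)[OF p \<alpha>] HL that by blast
    qed
  qed
  obtain l where l: "\<forall>i\<in>I. l i \<in> L" "\<exists>i\<in>I. l i \<noteq> 0" "(\<Sum>i\<in>I. mconst (l i) * msubst (g i) H) = 0"
    using dependence_descends[OF L I _ \<mu>] sub g unfolding poly_ring_iff[OF L] by blast
  have frac: "to_frac (\<Sum>i\<in>I. mconst (c i) * msubst (g i) H)
      = (\<Sum>i\<in>I. const_frac (c i) * to_frac (msubst (g i) H))" for c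
    by (simp add: is_hom_sum[OF is_hom_to_frac] is_hom_mult[OF is_hom_to_frac])
  have "\<exists>k. (\<forall>i\<in>I. k i \<in> K) \<and> (\<exists>i\<in>I. k i \<noteq> 0)
      \<and> (\<Sum>i\<in>I. const_frac (k i) * to_frac (msubst (g i) H)) = 0"
  proof (rule relation_over_constants[OF K L _ I l(1,2)])
    show "(\<Sum>i\<in>I. const_frac (l i) * to_frac (msubst (g i) H)) = 0"
      using frac[of l] unfolding l(3) is_hom_zero[OF is_hom_to_frac] by (rule sym)
    \<comment> \<open>A derivation of \<open>L\<close> that moves \<open>x\<close> is extended to
      the rational functions and then corrected so that it kills the components of \<open>H\<close>,
      without a change on \<open>L\<close>.\<close>
    fix x assume x: "x \<in> L - K"
    obtain D0 where D0: "derivation_on L D0" "D0 ` L \<subseteq> L" "\<forall>c\<in>K. D0 c = 0" "D0 x \<noteq> 0"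
      using derivation_moving[OF K L KL ac] x by blast
    obtain D1 where D1: "Der K D1" "\<forall>l\<in>L. D1 (const_frac l) = const_frac (D0 l)"
      using derivation_extend_const[OF L KL D0(1,3)] by blast
    obtain D where D: "Der K D" "\<forall>j<m. D (to_frac (H j)) = 0"
      "\<forall>l\<in>L. D (const_frac l) = D1 (const_frac l)"
      using derivation_killing_generators[OF K L KL tr D1(1)] by blast
    have Dd: "derivation D" using D(1) by (simp add: Der_def)
    \<comment> \<open>By the chain rule a \<open>K\<close>-derivation that kills the components of
      \<open>H\<close> kills all of K[H].\<close>
    have "D (to_frac (msubst p H)) = 0" if p: "p \<in> poly_ring K {..<m}" for p
    proof -
      have "D (to_frac (msubst p H))
        = (\<Sum>j<m. meval const_frac (mpderiv j p) (\<lambda>i. to_frac (H i)) * D (to_frac (H j)))"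
        unfolding to_frac_msubst using p D(1) unfolding poly_ring_iff[OF K]
        by (intro chain_rule[OF hom Dd]) (auto simp: Der_def)
      then show ?thesis using D(2) by simp
    qed
    then show "\<exists>D0 D. derivation_on L D0 \<and> D0 ` L \<subseteq> L \<and> D0 x \<noteq> 0 \<and> derivation D
        \<and> (\<forall>x\<in>L. D (const_frac x) = const_frac (D0 x))
        \<and> (\<forall>i\<in>I. D (to_frac (msubst (g i) H)) = 0)"
      using D0 D1(2) D(3) Dd g by (intro exI[of _ D0] exI[of _ D]) simp
  qed
  then show ?thesis unfolding frac[symmetric] to_frac_eq_0_iff .
qed

text \<open>A dependence over \<open>K\<close> among the \<open>\<gamma> i\<close> eliminates one of
  them. The changed coefficients are again independent over \<open>K\<close>, so induction on the
  number of terms applies.\<close>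

lemma independent_coefficients_vanish:
  fixes \<gamma> :: "'i \<Rightarrow> 'a::field mpoly"
  assumes K: "is_subfield K"
    and dep: "\<And>J \<mu>. J \<subseteq> I \<Longrightarrow> \<exists>i\<in>J. \<mu> i \<noteq> 0 \<Longrightarrow> (\<Sum>i\<in>J. mconst (\<mu> i) * \<gamma> i) = 0 \<Longrightarrow>
       \<exists>k. (\<forall>i\<in>J. k i \<in> K) \<and> (\<exists>i\<in>J. k i \<noteq> 0) \<and> (\<Sum>i\<in>J. mconst (k i) * \<gamma> i) = 0"
    and I: "finite I" and "indep_over K \<mu> I" "(\<Sum>i\<in>I. mconst (\<mu> i) * \<gamma> i) = 0"
  shows "\<forall>i\<in>I. \<gamma> i = 0"
proof -
  note hom = is_hom_mconst
  have "\<forall>i\<in>J. \<gamma> i = 0"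
    if "J \<subseteq> I" "indep_over K \<mu> J" "(\<Sum>i\<in>J. mconst (\<mu> i) * \<gamma> i) = 0" for J \<mu>
    using that
  proof (induct "card J" arbitrary: J \<mu>)
    case 0
    then have "J = {}" using finite_subset[OF 0(2) I] by simp
    then show ?case by simp
  next
    case (Suc d)
    have finJ: "finite J" using finite_subset[OF Suc(3) I] .
    obtain j where j: "j \<in> J" using Suc(2) by fastforce
    \<comment> \<open>A nonzero coefficient makes the given relation nontrivial, as
      \<open>dep\<close> demands.\<close>
    have "\<mu> j \<noteq> 0"
    proof
      assume "\<mu> j = 0"
      then have "(\<Sum>i\<in>J. (if i = j then 1 else 0) * \<mu> i) = 0" by (intro sum.neutral) auto
      then have "(if j = j then 1 else 0) = (0::'a)"
        using subfield_closed(1,2)[OF K]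
        by (intro indep_overD[OF Suc(4), of "\<lambda>i. if i = j then 1 else 0", OF _ _ j]) auto
      then show False by simp
    qed
    then obtain k where k: "\<forall>i\<in>J. k i \<in> K" "\<exists>i\<in>J. k i \<noteq> 0" "(\<Sum>i\<in>J. mconst (k i) * \<gamma> i) = 0"
      using dep[OF Suc(3) _ Suc(5)] j by blast
    obtain i0 where i0: "i0 \<in> J" "k i0 \<noteq> 0" using k(2) by blast
    define J' where "J' = J - {i0}"
    define r where "r i = - k i / k i0" for i
    have rK: "r i \<in> K" if "i \<in> J" for i
      unfolding r_def using k(1) i0(1) that by (intro subfield_closed[OF K]) auto
    have "mconst (inverse (k i0)) * (\<Sum>i\<in>J. mconst (k i) * \<gamma> i) = \<gamma> i0 - (\<Sum>i\<in>J'. mconst (r i) * \<gamma> i)"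
    proof -
      have "mconst (inverse (k i0)) * (\<Sum>i\<in>J. mconst (k i) * \<gamma> i)
          = (\<Sum>i\<in>J. mconst (- r i) * \<gamma> i)"
        unfolding sum_distrib_left
        by (intro sum.cong refl) (simp add: r_def is_hom_mult[OF hom, symmetric] divide_inverse
            mult.assoc[symmetric] mult.commute[of "inverse _"])
      also have "\<dots> = mconst (- r i0) * \<gamma> i0 + (\<Sum>i\<in>J'. mconst (- r i) * \<gamma> i)"
        unfolding J'_def by (rule sum.remove[OF finJ i0(1)])
      also have "mconst (- r i0) * \<gamma> i0 = \<gamma> i0"
        using i0(2) by (simp add: r_def is_hom_one[OF hom])
      finally show ?thesis by (simp add: is_hom_uminus[OF hom] sum_negf)
    qed
    then have \<gamma>0: "\<gamma> i0 = (\<Sum>i\<in>J'. mconst (r i) * \<gamma> i)" using k(3) by simp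
    \<comment> \<open>The coefficient of \<open>\<gamma> i\<close> after substitution of
      \<open>\<gamma>0\<close>.\<close>
    define \<mu>' where "\<mu>' i = \<mu> i + r i * \<mu> i0" for i
    have "indep_over K \<mu>' J'"
      unfolding indep_over_def
    proof (intro allI impI)
      fix c assume c: "(\<forall>j\<in>J'. c j \<in> K) \<and> (\<Sum>j\<in>J'. c j * \<mu>' j) = 0"
      \<comment> \<open>Pulls a relation among the \<open>\<mu>' j\<close> back to one among the
        \<open>\<mu> j\<close>.\<close>
      define d where "d = c(i0 := (\<Sum>j\<in>J'. c j * r j))"
      have "(\<Sum>j\<in>J. d j * \<mu> j) = d i0 * \<mu> i0 + (\<Sum>j\<in>J'. c j * \<mu> j)"
        unfolding sum.remove[OF finJ i0(1)] J'_def by (simp add: d_def)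
      also have "\<dots> = (\<Sum>j\<in>J'. c j * \<mu>' j)"
        by (simp add: d_def \<mu>'_def distrib_left sum.distrib sum_distrib_right mult.assoc add.commute)
      finally have "(\<Sum>j\<in>J. d j * \<mu> j) = 0" using c by simp
      moreover have "\<forall>j\<in>J. d j \<in> K"
        using c rK by (auto simp: d_def J'_def intro!: subfield_sum[OF K] subfield_closed[OF K])
      ultimately have "\<forall>j\<in>J. d j = 0" using indep_overD[OF Suc(4), of d] by blast
      moreover have "d j = c j" if "j \<in> J'" for j using that by (simp add: d_def J'_def)
      ultimately show "\<forall>j\<in>J'. c j = 0" by (simp add: J'_def)
    qed
    moreover have "(\<Sum>i\<in>J'. mconst (\<mu>' i) * \<gamma> i) = 0"
    proof -
      have "(\<Sum>i\<in>J'. mconst (\<mu>' i) * \<gamma> i)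
          = (\<Sum>i\<in>J'. mconst (\<mu> i) * \<gamma> i) + mconst (\<mu> i0) * (\<Sum>i\<in>J'. mconst (r i) * \<gamma> i)"
        unfolding sum_distrib_left sum.distrib[symmetric]
        by (intro sum.cong refl)
          (simp add: \<mu>'_def is_hom_add[OF hom] is_hom_mult[OF hom] algebra_simps)
      also have "\<dots> = (\<Sum>i\<in>J. mconst (\<mu> i) * \<gamma> i)"
        unfolding \<gamma>0[symmetric]
        unfolding sum.remove[OF finJ i0(1)] J'_def by simp
      finally show ?thesis using Suc(5) by simp
    qed
    moreover have "d = card J'" using Suc(2) finJ i0(1) by (simp add: J'_def)
    moreover have "J' \<subseteq> I" using Suc(3) by (auto simp: J'_def)
    ultimately have J'0: "\<forall>i\<in>J'. \<gamma> i = 0" using Suc(1) by blast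
    then have "\<gamma> i0 = 0" using \<gamma>0 by simp
    then show ?case using J'0 by (auto simp: J'_def)
  qed
  then show ?thesis using assms by blast
qed

text \<open>Linear disjointness in the form used below: elements of the big field that are
  independent over \<open>K\<close> stay independent over K[H]. It is applied both to the weights of
  the decomposition and to the coefficients of a relation over the big field.\<close>

lemma independent_relation_trivial:
  fixes K L :: "'a::field_char_0 set"
  assumes "is_subfield K" and "is_subfield L" and "K \<subseteq> L"
    and "alg_closed_in K L" and "\<forall>i<m. H i \<in> poly_ring L {..<n}"
    and "trdeg_gen K H m \<le> trdeg_gen L H m"
    and I: "finite I" and g: "\<forall>i\<in>I. g i \<in> poly_ring K {..<m}"
    and ind: "indep_over K \<mu> I" and rel: "(\<Sum>i\<in>I. mconst (\<mu> i) * msubst (g i) H) = 0"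
  shows "\<forall>i\<in>I. msubst (g i) H = 0"
proof (rule independent_coefficients_vanish[OF assms(1) _ I ind rel])
  fix J \<mu> assume J: "J \<subseteq> I" "\<exists>i\<in>J. \<mu> i \<noteq> 0" "(\<Sum>i\<in>J. mconst (\<mu> i) * msubst (g i) H) = 0"
  show "\<exists>k. (\<forall>i\<in>J. k i \<in> K) \<and> (\<exists>i\<in>J. k i \<noteq> 0) \<and> (\<Sum>i\<in>J. mconst (k i) * msubst (g i) H) = 0"
    using linear_disjointness[OF assms(1-6) finite_subset[OF J(1) I] _ J(2,3)] g J(1) by blast
qed

section \<open>Image apices\<close>

abbreviation const_poly :: "'a::field \<Rightarrow> 'a mpoly poly" where
  "const_poly c \<equiv> [:mconst c:]"

lemma is_hom_const_poly: "is_hom const_poly"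
  by (rule is_hom_comp[OF is_hom_pCons_zero is_hom_mconst])

text \<open>The polynomial \<open>f ((1 - t) H + t a)\<close> in \<open>t\<close>, over the ring containing the entries of \<open>H\<close>.\<close>
definition apex_poly :: "(nat \<Rightarrow> 'a::field mpoly) \<Rightarrow> (nat \<Rightarrow> 'a) \<Rightarrow> 'a mpoly \<Rightarrow> 'a mpoly poly" where
  "apex_poly H a f = meval const_poly f (\<lambda>j. [:H j, mconst (a j) - H j:])"

lemma poly_apex_poly: "poly (apex_poly H a f) x = meval mconst f (\<lambda>j. (1 - x) * H j + x * mconst (a j))"
proof -
  have "(\<lambda>j. poly [:H j, mconst (a j) - H j:] x) = (\<lambda>j. (1 - x) * H j + x * mconst (a j))"
    by (simp add: algebra_simps)
  then show ?thesis
    unfolding apex_poly_def hom_meval[OF is_hom_poly is_hom_const_poly] by simp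
qed

text \<open>The variable \<open>x\<^sub>n\<close> does not occur in \<open>H\<close>, so it may be replaced by the polynomial variable.\<close>
lemma apex_poly_eq_0_iff:
  assumes H: "\<forall>i<m. vars_in {..<n} (H i)" and f: "vars_in {..<m} f"
  shows "apex_poly H a f = 0 \<longleftrightarrow> msubst f (\<lambda>i. (1 - mvar n) * H i + mvar n * mconst (a i)) = 0"
    (is "_ \<longleftrightarrow> ?s = 0")
proof
  assume "apex_poly H a f = 0"
  then show "?s = 0" using poly_apex_poly[of H a f "mvar n"] by (simp add: msubst_def)
next
  assume s: "?s = 0"
  note hc = is_hom_const_poly
  define \<tau> where "\<tau> p = meval const_poly p (\<lambda>i. if i = n then [:0, 1:] else [:mvar i:])" for p :: "'a mpoly"
  have \<tau>: "is_hom \<tau>" unfolding \<tau>_def by (rule is_hom_meval[OF hc])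
  have \<tau>c: "\<tau> (mconst c) = const_poly c" for c by (simp add: \<tau>_def meval_mconst[OF hc])
  have \<tau>n: "\<tau> (mvar n) = [:0, 1:]" by (simp add: \<tau>_def meval_mvar[OF hc])
  have \<tau>H: "\<tau> (H i) = [:H i:]" if "i < m" for i
  proof -
    have "\<tau> (H i) = meval const_poly (H i) (\<lambda>i. [:mvar i:])"
      unfolding \<tau>_def by (rule meval_cong_vars) (use H that in auto)
    also have "\<dots> = [:meval mconst (H i) mvar:]"
      by (rule hom_meval[OF is_hom_pCons_zero is_hom_mconst, symmetric])
    finally show ?thesis by (simp add: meval_mvar_id)
  qed
  have "\<tau> ?s = meval const_poly f (\<lambda>i. \<tau> ((1 - mvar n) * H i + mvar n * mconst (a i)))"
    unfolding msubst_def hom_meval[OF \<tau> is_hom_mconst] by (simp add: \<tau>c)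
  also have "\<dots> = apex_poly H a f" unfolding apex_poly_def
  proof (rule meval_cong_vars[OF f])
    fix i assume i: "i \<in> {..<m}"
    show "\<tau> ((1 - mvar n) * H i + mvar n * mconst (a i)) = [:H i, mconst (a i) - H i:]"
      using i by (simp add: is_hom_add[OF \<tau>] is_hom_mult[OF \<tau>] is_hom_diff[OF \<tau>] is_hom_one[OF \<tau>]
          \<tau>c \<tau>n \<tau>H one_pCons)
  qed
  finally show "apex_poly H a f = 0" using s is_hom_zero[OF \<tau>] by simp
qed

text \<open>This is the derivative at t = 0 of f((1 - t) y + t a). In contrast to the condition for
  an image apex itself, it is affine in \<open>a\<close>.\<close>

definition apex_deriv :: "nat \<Rightarrow> (nat \<Rightarrow> 'a::field) \<Rightarrow> 'a mpoly \<Rightarrow> 'a mpoly" where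
  "apex_deriv m a f = (\<Sum>j<m. mpderiv j f * (mconst (a j) - mvar j))"

lemma msubst_apex_deriv:
  "msubst (apex_deriv m a f) H = (\<Sum>j<m. msubst (mpderiv j f) H * (mconst (a j) - H j))"
proof -
  have "is_hom (\<lambda>p. msubst p H)" unfolding msubst_def by (rule is_hom_meval[OF is_hom_mconst])
  note hom = this
  show ?thesis
    by (simp add: apex_deriv_def is_hom_sum[OF hom] is_hom_mult[OF hom] is_hom_diff[OF hom])
      (simp add: msubst_def meval_mconst[OF is_hom_mconst] meval_mvar[OF is_hom_mconst])
qed

lemma apex_deriv_in_poly_ring:
  assumes F: "is_subfield F" and "\<forall>j<m. a j \<in> F" "f \<in> poly_ring F {..<m}"
  shows "apex_deriv m a f \<in> poly_ring F {..<m}"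
  unfolding apex_deriv_def
proof (intro poly_ring_sum[OF F] poly_ring_mult[OF F] mpderiv_in_poly_ring[OF F assms(3)])
  fix j assume "j \<in> {..<m}"
  then have "mconst (a j) + - mvar j \<in> poly_ring F {..<m}"
    using assms(2) by (intro poly_ring_add[OF F] poly_ring_uminus[OF F] mconst_in_poly_ring[OF F]
        mvar_in_poly_ring[OF F]) auto
  then show "mconst (a j) - mvar j \<in> poly_ring F {..<m}" by simp
qed

lemma pderiv_apex_poly:
  fixes H :: "nat \<Rightarrow> 'a::field_char_0 mpoly"
  assumes "vars_in {..<m} f"
  shows "pderiv (apex_poly H a f)
    = (\<Sum>j<m. meval const_poly (mpderiv j f) (\<lambda>j. [:H j, mconst (a j) - H j:]) * [:mconst (a j) - H j:])"
proof -
  have "derivation (pderiv :: 'a mpoly poly \<Rightarrow> _)"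
    by (simp add: derivation_on_def pderiv_add pderiv_mult)
  from chain_rule[OF is_hom_const_poly this _ assms, of "\<lambda>j. [:H j, mconst (a j) - H j:]"]
  show ?thesis by (simp add: apex_poly_def pderiv_pCons)
qed

text \<open>The derivative of \<open>apex_poly H a f\<close> at t = 0 is the value of
  \<open>apex_deriv m a f\<close> at \<open>H\<close>. The entries of \<open>a\<close> may lie
  outside the field of coefficients of \<open>f\<close>.\<close>

lemma apex_deriv_vanishes:
  fixes H :: "nat \<Rightarrow> 'a::field_char_0 mpoly"
  assumes "vars_in {..<m} f" "apex_poly H a f = 0"
  shows "msubst (apex_deriv m a f) H = 0"
proof -
  have m: "poly (meval const_poly p (\<lambda>j. [:H j, mconst (a j) - H j:])) 0 = msubst p H" for p
    using poly_apex_poly[of H a p 0] by (simp add: apex_poly_def msubst_def)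
  have "poly (pderiv (apex_poly H a f)) 0 = msubst (apex_deriv m a f) H"
    unfolding pderiv_apex_poly[OF assms(1)] msubst_apex_deriv by (simp add: poly_sum m mult.commute)
  then show ?thesis using assms(2) by simp
qed

text \<open>At the point (1 - t) H + t a the factor a_j - y_j becomes (1 - t)(a_j - H_j), so 1 - t
  can be taken out of the chain rule.\<close>

lemma apex_poly_apex_deriv:
  fixes H :: "nat \<Rightarrow> 'a::field_char_0 mpoly"
  assumes "vars_in {..<m} f"
  shows "apex_poly H a (apex_deriv m a f) = [:1, - 1:] * pderiv (apex_poly H a f)"
proof -
  note hc = is_hom_const_poly
  let ?z = "\<lambda>j. [:H j, mconst (a j) - H j:]"
  have hom: "is_hom (\<lambda>p. meval const_poly p ?z)" by (rule is_hom_meval[OF hc])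
  have "apex_poly H a (apex_deriv m a f)
      = (\<Sum>j<m. meval const_poly (mpderiv j f) ?z * (const_poly (a j) - ?z j))"
    unfolding apex_poly_def apex_deriv_def
    by (simp only: is_hom_sum[OF hom] is_hom_mult[OF hom] is_hom_diff[OF hom]
        meval_mconst[OF hc] meval_mvar[OF hc])
  also have "\<dots> = (\<Sum>j<m. [:1, - 1:] * (meval const_poly (mpderiv j f) ?z * [:mconst (a j) - H j:]))"
  proof (rule sum.cong[OF refl])
    fix j
    have "const_poly (a j) - ?z j = [:1, - 1:] * [:mconst (a j) - H j:]" by simp
    then show "meval const_poly (mpderiv j f) ?z * (const_poly (a j) - ?z j)
        = [:1, - 1:] * (meval const_poly (mpderiv j f) ?z * [:mconst (a j) - H j:])"
      by (simp only: ac_simps)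
  qed
  finally show ?thesis unfolding pderiv_apex_poly[OF assms] sum_distrib_left .
qed

text \<open>If the ideal of \<open>H\<close> is closed under \<open>f \<mapsto> \<Sum>\<^sub>j (a\<^sub>j - y\<^sub>j) \<partial>\<^sub>j f\<close>, then \<open>\<phi>\<^sub>f = apex_poly H a f\<close>
  satisfies \<open>\<phi>\<^sub>f(0) = 0\<close> and \<open>(1 - t) \<phi>\<^sub>f'\<close> is again of this form, which forces \<open>\<phi>\<^sub>f = 0\<close> order by order.\<close>
lemma apex_poly_vanishes:
  fixes H :: "nat \<Rightarrow> 'a::field_char_0 mpoly"
  assumes F: "is_subfield F" and a: "\<forall>j<m. a j \<in> F"
    and closed: "\<And>f. f \<in> poly_ring F {..<m} \<Longrightarrow> msubst f H = 0 \<Longrightarrow> msubst (apex_deriv m a f) H = 0"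
    and f: "f \<in> poly_ring F {..<m}" "msubst f H = 0"
  shows "apex_poly H a f = 0"
proof -
  have "coeff (apex_poly H a f) k = 0" if "f \<in> poly_ring F {..<m}" "msubst f H = 0" for f k
    using that
  proof (induct k arbitrary: f)
    case 0
    then show ?case using poly_apex_poly[of H a f 0] by (simp add: poly_0_coeff_0 msubst_def)
  next
    case (Suc k)
    let ?\<phi> = "apex_poly H a f"
    have "coeff ([:1, - 1:] * pderiv ?\<phi>) k = 0"
      unfolding apex_poly_apex_deriv[OF poly_ringD(3)[OF Suc(2)], symmetric]
      using Suc closed apex_deriv_in_poly_ring[OF F a] by blast
    \<comment> \<open>The recursion expresses k + 1 times the next coefficient through the previous
      one, and k + 1 is nonzero in characteristic zero.\<close>
    moreover have "coeff ([:1, - 1:] * pderiv ?\<phi>) k = of_nat (Suc k) * coeff ?\<phi> (Suc k) - of_nat k * coeff ?\<phi> k"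
      by (cases k) (simp_all add: coeff_pderiv)
    ultimately have "of_nat (Suc k) * coeff ?\<phi> (Suc k) = 0" using Suc(1)[OF Suc(2,3)] by simp
    then show ?case by (simp del: of_nat_Suc)
  qed
  then show ?thesis using f by (intro poly_eqI) simp
qed

section \<open>Decomposition of an image apex\<close>

theorem theorem4p8:
  fixes K L :: "'a::field_char_0 set"
    and n m :: nat
    and H :: "nat \<Rightarrow> 'a mpoly"
    and a :: "nat \<Rightarrow> 'a"
  assumes "is_subfield K" and "is_subfield L" and "K \<subseteq> L"
    and "alg_closed_in K L"
    and "\<forall>i<m. H i \<in> poly_ring L {..<n}"
    and "trdeg_gen K H m \<le> trdeg_gen L H m"
    and "image_apex K n m H a"
  shows "\<exists>r::nat. \<exists>\<mu>::nat \<Rightarrow> 'a. \<exists>A::nat \<Rightarrow> nat \<Rightarrow> 'a.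
           (\<forall>c. (\<forall>i<r. c i \<in> K) \<and> (\<Sum>i<r. c i * \<mu> i) = 0 \<longrightarrow> (\<forall>i<r. c i = 0))
         \<and> (\<Sum>i<r. \<mu> i) = 1
         \<and> (\<forall>i<r. \<forall>j<m. A i j \<in> K)
         \<and> (\<forall>j<m. a j = (\<Sum>i<r. \<mu> i * A i j))
         \<and> (\<forall>i<r. image_apex UNIV n m H (A i))"
proof -
  note K = assms(1)
  have HV: "\<forall>i<m. vars_in {..<n} (H i)" using assms(5) poly_ringD(3) by blast
  note disjoint = independent_relation_trivial[OF assms(1-6)]
  \<comment> \<open>Index 0 carries the constant 1 and index i + 1 the entry
    \<open>a i\<close>.\<close>
  define v where "v i = (case i of 0 \<Rightarrow> 1 | Suc j \<Rightarrow> a j)" for i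
  have "indep_over K v {0}" by (simp add: indep_over_def v_def)
  then obtain J c where J: "{0} \<subseteq> J" "J \<subseteq> {..m}" "indep_over K v J"
    and c: "\<forall>i\<in>{..m}. (\<forall>j\<in>J. c i j \<in> K) \<and> v i = (\<Sum>j\<in>J. c i j * v j)"
    using basis_extension[OF K, of "{..m}" "{0}" v] by auto
  have finJ: "finite J" using J(2) finite_subset by blast
  have J0: "0 \<in> J" using J(1) by simp
  \<comment> \<open>The basis element 1 is replaced by 1 minus the sum of the other basis elements,
    so that the new basis has sum 1.\<close>
  define \<mu> where "\<mu> j = (if j = 0 then 1 - (\<Sum>i\<in>J - {0}. v i) else v j)" for j
  \<comment> \<open>Coordinates of the entries in the new basis: since 1 is the sum of the
    \<open>\<mu> j\<close>, the old coordinate at 1 is added to all the others.\<close>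
  define A where "A j i = (if j = 0 then c (Suc i) 0 else c (Suc i) 0 + c (Suc i) j)" for j i
  have \<mu>': "(\<Sum>j\<in>J - {0}. d j * \<mu> j) = (\<Sum>j\<in>J - {0}. d j * v j)" for d
    by (intro sum.cong) (auto simp: \<mu>_def)
  have \<mu>1: "(\<Sum>j\<in>J. \<mu> j) = 1"
    unfolding sum.remove[OF finJ J0] using \<mu>'[of "\<lambda>_. 1"] by (simp add: \<mu>_def)
  have \<mu>ind: "indep_over K \<mu> J"
    unfolding indep_over_def
  proof (intro allI impI)
    fix d assume d: "(\<forall>j\<in>J. d j \<in> K) \<and> (\<Sum>j\<in>J. d j * \<mu> j) = 0"
    \<comment> \<open>The coordinates with respect to \<open>v\<close> of the combination of the
      \<open>\<mu> j\<close> with coefficients \<open>d\<close>.\<close>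
    define d' where "d' j = (if j = 0 then d 0 else d j - d 0)" for j
    have "(\<Sum>j\<in>J - {0}. d' j * v j) = (\<Sum>j\<in>J - {0}. d j * v j) - (\<Sum>j\<in>J - {0}. d 0 * v j)"
      unfolding sum_subtractf[symmetric] by (intro sum.cong) (auto simp: d'_def algebra_simps)
    then have "(\<Sum>j\<in>J. d' j * v j) = (\<Sum>j\<in>J. d j * \<mu> j)"
      unfolding sum.remove[OF finJ J0] \<mu>'
      by (simp add: d'_def \<mu>_def v_def sum_distrib_left right_diff_distrib)
    then have "(\<Sum>j\<in>J. d' j * v j) = 0" using d by simp
    moreover have "d' j \<in> K" if "j \<in> J" for j
      using d that J0 by (auto simp: d'_def intro!: subfield_closed(7)[OF K])
    ultimately have d'0: "d' j = 0" if "j \<in> J" for j using indep_overD[OF J(3), of d'] that by blast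
    have "d j = 0" if "j \<in> J" for j
      using d'0[OF that] d'0[OF J0] by (cases "j = 0") (auto simp: d'_def)
    then show "\<forall>j\<in>J. d j = 0" by blast
  qed
  have AK: "A j i \<in> K" if "j \<in> J" "i < m" for j i
    using c that J0 by (auto simp: A_def intro!: subfield_closed(3)[OF K])
  have aA: "a i = (\<Sum>j\<in>J. \<mu> j * A j i)" if "i < m" for i
  proof -
    have "(\<Sum>j\<in>J. \<mu> j * A j i) = \<mu> 0 * c (Suc i) 0 + (\<Sum>j\<in>J - {0}. \<mu> j * c (Suc i) 0 + c (Suc i) j * \<mu> j)"
      unfolding sum.remove[OF finJ J0]
      by (simp add: A_def) (intro sum.cong, auto simp: algebra_simps)
    also have "\<dots> = (\<Sum>j\<in>J. \<mu> j) * c (Suc i) 0 + (\<Sum>j\<in>J - {0}. c (Suc i) j * v j)"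
      unfolding sum.remove[OF finJ J0] by (simp add: sum.distrib \<mu>' sum_distrib_right distrib_right)
    also have "\<dots> = (\<Sum>j\<in>J. c (Suc i) j * v j)"
      unfolding \<mu>1 unfolding sum.remove[OF finJ J0] by (simp add: v_def)
    also have "\<dots> = v (Suc i)" using c that by simp
    finally show ?thesis by (simp add: v_def)
  qed
  \<comment> \<open>First for relations over \<open>K\<close>: the entries of \<open>A j\<close> lie
    in \<open>K\<close>, so it suffices that these relations are closed under
    \<open>apex_deriv m (A j)\<close>.\<close>
  have apexK: "apex_poly H (A j) f = 0"
    if j: "j \<in> J" and f: "f \<in> poly_ring K {..<m}" "msubst f H = 0" for j f
  proof (rule apex_poly_vanishes[OF K _ _ f])
    show "\<forall>i<m. A j i \<in> K" using AK j by blast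
    fix f assume f: "f \<in> poly_ring K {..<m}" "msubst f H = 0"
    note fv = poly_ringD(3)[OF f(1)]
    have "apex_poly H a f = 0"
      using assms(7) f unfolding apex_poly_eq_0_iff[OF HV fv] image_apex_def by blast
    then have *: "msubst (apex_deriv m a f) H = 0" by (rule apex_deriv_vanishes[OF fv])
    \<comment> \<open>As \<open>apex_deriv\<close> is affine in its point and the weights have sum
      1, the value for \<open>a\<close> is the weighted sum of the values for the
      \<open>A j\<close>.\<close>
    have "(\<Sum>j\<in>J. mconst (\<mu> j) * msubst (apex_deriv m (A j) f) H) = msubst (apex_deriv m a f) H"
    proof -
      note hom = is_hom_mconst
      have H1: "H i = (\<Sum>j\<in>J. mconst (\<mu> j) * H i)" for i
        unfolding sum_distrib_right[symmetric] is_hom_sum[OF hom, symmetric] \<mu>1 is_hom_one[OF hom] by simp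
      have "mconst (a i) - H i = (\<Sum>j\<in>J. mconst (\<mu> j) * (mconst (A j i) - H i))" if "i < m" for i
        using H1[of i] unfolding aA[OF that]
        by (simp add: is_hom_sum[OF hom] is_hom_mult[OF hom] right_diff_distrib sum_subtractf)
      then have "msubst (apex_deriv m a f) H = (\<Sum>i<m. msubst (mpderiv i f) H
          * (\<Sum>j\<in>J. mconst (\<mu> j) * (mconst (A j i) - H i)))"
        by (simp add: msubst_apex_deriv)
      also have "\<dots> = (\<Sum>j\<in>J. mconst (\<mu> j) * msubst (apex_deriv m (A j) f) H)"
        unfolding msubst_apex_deriv sum_distrib_left by (subst sum.swap) (simp only: ac_simps)
      finally show ?thesis by simp
    qed
    with * have "(\<Sum>j\<in>J. mconst (\<mu> j) * msubst (apex_deriv m (A j) f) H) = 0" by simp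
    \<comment> \<open>The weights are independent over \<open>K\<close> and each
      \<open>apex_deriv m (A j) f\<close> has coefficients in \<open>K\<close>, so the terms vanish
      one by one.\<close>
    then have "\<forall>j\<in>J. msubst (apex_deriv m (A j) f) H = 0"
      using f(1) AK by (intro disjoint[OF finJ _ \<mu>ind] ballI apex_deriv_in_poly_ring[OF K]) auto
    then show "msubst (apex_deriv m (A j) f) H = 0" using j by blast
  qed
  \<comment> \<open>From \<open>K\<close> to the big field: in a \<open>K\<close>-basis of the span
    of its coefficients, \<open>f\<close> is a combination of polynomials \<open>g \<beta>\<close>
    over \<open>K\<close>. Disjointness makes each of these a relation of \<open>H\<close>, to which
    the case over \<open>K\<close> applies.\<close>
  have apex: "image_apex UNIV n m H (A j)" if j: "j \<in> J" for j
    unfolding image_apex_def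
  proof (intro ballI impI)
    fix f :: "'a mpoly" assume f: "f \<in> poly_ring UNIV {..<m}" "msubst f H = 0"
    let ?w = "Poly_Mapping.lookup f"
    have ind: "indep_over K ?w {}" by (simp add: indep_over_def)
    obtain B e where B: "B \<subseteq> Poly_Mapping.keys f" "indep_over K ?w B"
      and e: "\<forall>\<alpha>\<in>Poly_Mapping.keys f. (\<forall>\<beta>\<in>B. e \<alpha> \<beta> \<in> K) \<and> ?w \<alpha> = (\<Sum>\<beta>\<in>B. e \<alpha> \<beta> * ?w \<beta>)"
      using basis_extension[OF K finite_keys[of f] empty_subsetI ind] by blast
    have finB: "finite B" using B(1) by (rule finite_subset) simp
    define g where "g \<beta> = (\<Sum>\<alpha>\<in>Poly_Mapping.keys f. Poly_Mapping.single \<alpha> (e \<alpha> \<beta>))" for \<beta>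
    have g: "g \<beta> \<in> poly_ring K {..<m}" if "\<beta> \<in> B" for \<beta>
      unfolding g_def using e that poly_ringD(2)[OF f(1)]
      by (intro poly_ring_sum[OF K] single_in_poly_ring) auto
    have fg: "f = (\<Sum>\<beta>\<in>B. mconst (?w \<beta>) * g \<beta>)"
    proof -
      have "(\<Sum>\<beta>\<in>B. mconst (?w \<beta>) * g \<beta>)
          = (\<Sum>\<alpha>\<in>Poly_Mapping.keys f. \<Sum>\<beta>\<in>B. Poly_Mapping.single \<alpha> (e \<alpha> \<beta> * ?w \<beta>))"
        unfolding g_def sum_distrib_left
        by (subst sum.swap) (simp add: mconst_def mult_single mult.commute)
      also have "\<dots> = (\<Sum>\<alpha>\<in>Poly_Mapping.keys f. Poly_Mapping.single \<alpha> (\<Sum>\<beta>\<in>B. e \<alpha> \<beta> * ?w \<beta>))"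
      proof -
        have "(\<Sum>\<beta>\<in>X. Poly_Mapping.single \<alpha> (q \<beta>)) = Poly_Mapping.single \<alpha> (sum q X)"
          for X :: "(nat \<Rightarrow>\<^sub>0 nat) set" and q :: "_ \<Rightarrow> 'a" and \<alpha> :: "nat \<Rightarrow>\<^sub>0 nat"
          by (induct X rule: infinite_finite_induct) (simp_all add: single_add)
        then show ?thesis by simp
      qed
      also have "\<dots> = (\<Sum>\<alpha>\<in>Poly_Mapping.keys f. Poly_Mapping.single \<alpha> (?w \<alpha>))"
        using e by (intro sum.cong) auto
      finally show ?thesis using poly_mapping_eq_sum_single[of f] by simp
    qed
    have sub: "msubst f z = (\<Sum>\<beta>\<in>B. mconst (?w \<beta>) * msubst (g \<beta>) z)" for z
    proof -
      have hom: "is_hom (\<lambda>p. msubst p z)" unfolding msubst_def by (rule is_hom_meval[OF is_hom_mconst])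
      have "msubst (mconst b) z = mconst b" for b
        by (simp add: msubst_def meval_mconst[OF is_hom_mconst])
      then show ?thesis by (subst fg) (simp add: is_hom_sum[OF hom] is_hom_mult[OF hom])
    qed
    have "\<forall>\<beta>\<in>B. msubst (g \<beta>) H = 0"
      using disjoint[OF finB _ B(2)] g f(2) unfolding sub[of H] by blast
    then have "\<forall>\<beta>\<in>B. apex_poly H (A j) (g \<beta>) = 0" using apexK[OF j] g by blast
    then have "\<forall>\<beta>\<in>B. msubst (g \<beta>) (\<lambda>i. (1 - mvar n) * H i + mvar n * mconst (A j i)) = 0"
      using apex_poly_eq_0_iff[OF HV poly_ringD(3)[OF g]] by blast
    then show "msubst f (\<lambda>i. (1 - mvar n) * H i + mvar n * mconst (A j i)) = 0"
      unfolding sub by simp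
  qed
  \<comment> \<open>The index set \<open>J\<close> is renumbered by the naturals below
    \<open>r\<close>.\<close>
  define r where "r = card J"
  obtain b where b: "bij_betw b {..<r} J"
    using ex_bij_betw_nat_finite[OF finJ] by (auto simp: r_def atLeast0LessThan)
  have bJ: "b i \<in> J" if "i < r" for i using b that by (auto simp: bij_betw_def)
  have re: "(\<Sum>i<r. q (b i)) = sum q J" for q :: "nat \<Rightarrow> 'a" by (rule sum.reindex_bij_betw[OF b])
  have "\<forall>i<r. d i = 0" if d: "\<forall>i<r. d i \<in> K" "(\<Sum>i<r. d i * \<mu> (b i)) = 0" for d
  proof -
    define b' where "b' = inv_into {..<r} b"
    have b': "b' (b i) = i" if "i < r" for i
      using b that by (simp add: b'_def bij_betw_def inv_into_f_f)
    have "(\<Sum>j\<in>J. d (b' j) * \<mu> j) = (\<Sum>i<r. d i * \<mu> (b i))"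
      unfolding re[symmetric] by (intro sum.cong) (auto simp: b')
    then have s0: "(\<Sum>j\<in>J. d (b' j) * \<mu> j) = 0" using d(2) by simp
    have dK: "d (b' j) \<in> K" if j: "j \<in> J" for j
    proof -
      obtain i where "i < r" "j = b i" using b j by (auto simp: bij_betw_def)
      then show ?thesis using d b' by simp
    qed
    have d0: "d (b' j) = 0" if "j \<in> J" for j
      by (rule indep_overD[OF \<mu>ind dK s0 that])
    show ?thesis
    proof (intro allI impI)
      fix i assume i: "i < r"
      show "d i = 0" using d0[OF bJ[OF i]] b'[OF i] by simp
    qed
  qed
  moreover have "a i = (\<Sum>k<r. \<mu> (b k) * A (b k) i)" if "i < m" for i
    using aA[OF that] re[of "\<lambda>j. \<mu> j * A j i"] by simp
  moreover have "(\<Sum>k<r. \<mu> (b k)) = 1" using re[of \<mu>] \<mu>1 by simp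
  ultimately show ?thesis using AK bJ apex
    by (intro exI[of _ r] exI[of _ "\<lambda>i. \<mu> (b i)"] exI[of _ "\<lambda>i. A (b i)"] conjI) simp_all
qed

end
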